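(* Let $X\in\mathbb R^p$, $Y\in\mathbb R^q$ be random vectors, $Z=(X^\top,Y^\top)^\top$, and let $Z_i=(X_i^\top,Y_i^\top)^\top$, $i=1,\dots,n$, be i.i.d. copies of $Z$. Let $w_p$ on $\mathbb R^p$ and $w_q$ on $\mathbb R^q$ each satisfy assumption (A), with characteristic functions $C_{w_p},C_{w_q}$. Define $$U_{n,1}=\tfrac{1}{n(n-1)}\sum_{i\ne j}C_{w_p}(X_i-X_j)C_{w_q}(Y_i-Y_j),\quad U_{n,2}=\tfrac{1}{n(n-1)}\sum_{i\ne j}C_{w_p}(X_i-X_j),\quad U_{n,3}=\tfrac{1}{n(n-1)}\sum_{i\ne j}C_{w_q}(Y_i-Y_j),$$ $$U_{n,4}=\tfrac{1}{n(n-1)(n-2)}\sum_{i,j,k\ \text{pairwise distinct}}C_{w_p}(X_i-X_j)C_{w_q}(Y_i-Y_k),$$ and $\Delta^{(\mathcal I)}_{n,w}=U_{n,1}+U_{n,2}U_{n,3}-2U_{n,4}$. Let $S_1=\mathbb E[C_{w_p}(X-X_1)C_{w_q}(Y-Y_1)]$, $S_2=\mathbb E[C_{w_p}(X-X_1)]$, $S_3=\mathbb E[C_{w_q}(Y-Y_1)]$, $S_4=\mathbb E[C_{w_p}(X-X_1)C_{w_q}(Y-Y_2)]$, where $Z_1,Z_2$ are independent copies of $Z$. Then, as $n\to\infty$: (i) if $\Delta^{(\mathcal I)}_{w,Z}>0$, then $\sqrt n\,(\Delta^{(\mathcal I)}_{n,w}-\Delta^{(\mathcal I)}_{w,Z})\to\mathcal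 N(0,\sigma^{2(\mathcal I)}_w)$ in distribution, where $$\sigma^{2(\mathcal I)}_w=\sum_{i,j=1}^4 m_im_j\,h_i'h_j'\,\zeta_1(i,j),$$ with $m_1=m_2=m_3=2$, $m_4=3$, $(h_1',h_2',h_3',h_4')=(1,S_3,S_2,-2)$ (the gradient of $h(u)=u_1+u_2u_3-2u_4$ at $u=(S_1,\dots,S_4)$), and $\zeta_1(i,j)=\mathrm{Cov}\big(\psi^{\mathcal I,i}_1(Z),\psi^{\mathcal I,j}_1(Z)\big)$, where $\psi^{\mathcal I,i}_1(z)=\mathbb E[\psi^{\mathcal I,i}(z,Z_1,\dots,Z_{m_i-1})]$ with $Z_1,\dots$ i.i.d. copies of $Z$, and the kernels are $\psi^{\mathcal I,1}(z,z_1)=C_{w_p}(x-x_1)C_{w_q}(y-y_1)$, $\psi^{\mathcal I,2}(z,z_1)=C_{w_p}(x-x_1)$, $\psi^{\mathcal I,3}(z,z_1)=C_{w_q}(y-y_1)$, and $\psi^{\mathcal I,4}(z,z_1,z_2)=\tfrac16\{C_{w_p}(x-x_1)C_{w_q}(y-y_2)+C_{w_p}(x-x_2)C_{w_q}(y-y_1)+C_{w_p}(x-x_1)C_{w_q}(y_1-y_2)+C_{w_p}(x_1-x_2)C_{w_q}(y-y_1)+C_{w_p}(x-x_2)C_{w_q}(y_1-y_2)+C_{w_p}(x_1-x_2)C_{w_q}(y-y_2)\}$ (writing $z=(x^\top,y^\top)^\top$ etc.); (ii) if $\Delta^{(\mathcal I)}_{w,Z}=0$, then $\sqrt n\,\Delta^{(\mathcal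 I)}_{n,w}\to0$ in probability.
   Context: Assumption (A) for a weight $w$ on $\mathbb R^d$: $w$ is a probability density symmetric about the origin, $w(t)=w(-t)$, $\int w=1$; its characteristic function is real-valued. The independence distance is $\Delta^{(\mathcal I)}_{w,Z}=\int_{\mathbb R^{p+q}}|\varphi_{X,Y}(t_1,t_2)-\varphi_X(t_1)\varphi_Y(t_2)|^2w_p(t_1)w_q(t_2)\,dt_1dt_2$, where $\varphi_{X,Y}$ is the joint characteristic function and $\varphi_X,\varphi_Y$ the marginal ones; it equals $S_1+S_2S_3-2S_4$ and vanishes iff $X$ and $Y$ are independent. No moment assumptions are imposed. *)

theory Defs
  imports "HOL-Probability.Probability"
begin

definition weightA :: "('a::euclidean_space \<Rightarrow> real) \<Rightarrow> bool" where
  "weightA w \<longleftrightarrow> w \<in> borel_measurable lborel \<and> (\<forall>t. 0 \<le> w t) \<and>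
     (\<forall>t. w (- t) = w t) \<and> integrable lborel w \<and> integral\<^sup>L lborel w = 1"

text \<open>Characteristic function of the density w (complex-valued), and its real-valued
  version C_w (the characteristic function is real under assumption (A)).\<close>
definition cf_w :: "('a::euclidean_space \<Rightarrow> real) \<Rightarrow> 'a \<Rightarrow> complex" where
  "cf_w w t = (CLINT x|lborel. cis (t \<bullet> x) * complex_of_real (w x))"

definition C_w :: "('a::euclidean_space \<Rightarrow> real) \<Rightarrow> 'a \<Rightarrow> real" where
  "C_w w t = Re (cf_w w t)"

definition phi_XY :: "('a::euclidean_space \<times> 'b::euclidean_space) measure \<Rightarrow> 'a \<Rightarrow> 'b \<Rightarrow> complex" where
  "phi_XY mu t1 t2 = (CLINT z|mu. cis (t1 \<bullet> fst z + t2 \<bullet> snd z))"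

definition phi_X :: "('a::euclidean_space \<times> 'b::euclidean_space) measure \<Rightarrow> 'a \<Rightarrow> complex" where
  "phi_X mu t1 = (CLINT z|mu. cis (t1 \<bullet> fst z))"

definition phi_Y :: "('a::euclidean_space \<times> 'b::euclidean_space) measure \<Rightarrow> 'b \<Rightarrow> complex" where
  "phi_Y mu t2 = (CLINT z|mu. cis (t2 \<bullet> snd z))"

definition indep_dist ::
  "('a::euclidean_space \<Rightarrow> real) \<Rightarrow> ('b::euclidean_space \<Rightarrow> real) \<Rightarrow> ('a \<times> 'b) measure \<Rightarrow> real" where
  "indep_dist wp wq mu =
     (LINT t|(lborel \<Otimes>\<^sub>M lborel).
        (cmod (phi_XY mu (fst t) (snd t) - phi_X mu (fst t) * phi_Y mu (snd t)))\<^sup>2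
        * wp (fst t) * wq (snd t))"

definition U1 :: "('a::euclidean_space \<Rightarrow> real) \<Rightarrow> ('b::euclidean_space \<Rightarrow> real) \<Rightarrow> (nat \<Rightarrow> 'a \<times> 'b) \<Rightarrow> nat \<Rightarrow> real" where
  "U1 wp wq z n = (\<Sum>i<n. \<Sum>j<n. if i \<noteq> j then
      C_w wp (fst (z i) - fst (z j)) * C_w wq (snd (z i) - snd (z j)) else 0) / (real n * (real n - 1))"

definition U2 :: "('a::euclidean_space \<Rightarrow> real) \<Rightarrow> (nat \<Rightarrow> 'a \<times> 'b) \<Rightarrow> nat \<Rightarrow> real" where
  "U2 wp z n = (\<Sum>i<n. \<Sum>j<n. if i \<noteq> j then
      C_w wp (fst (z i) - fst (z j)) else 0) / (real n * (real n - 1))"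

definition U3 :: "('b::euclidean_space \<Rightarrow> real) \<Rightarrow> (nat \<Rightarrow> 'a \<times> 'b) \<Rightarrow> nat \<Rightarrow> real" where
  "U3 wq z n = (\<Sum>i<n. \<Sum>j<n. if i \<noteq> j then
      C_w wq (snd (z i) - snd (z j)) else 0) / (real n * (real n - 1))"

definition U4 :: "('a::euclidean_space \<Rightarrow> real) \<Rightarrow> ('b::euclidean_space \<Rightarrow> real) \<Rightarrow> (nat \<Rightarrow> 'a \<times> 'b) \<Rightarrow> nat \<Rightarrow> real" where
  "U4 wp wq z n = (\<Sum>i<n. \<Sum>j<n. \<Sum>k<n. if i \<noteq> j \<and> i \<noteq> k \<and> j \<noteq> k then
      C_w wp (fst (z i) - fst (z j)) * C_w wq (snd (z i) - snd (z k)) else 0)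
      / (real n * (real n - 1) * (real n - 2))"

definition Delta_n :: "('a::euclidean_space \<Rightarrow> real) \<Rightarrow> ('b::euclidean_space \<Rightarrow> real) \<Rightarrow> (nat \<Rightarrow> 'a \<times> 'b) \<Rightarrow> nat \<Rightarrow> real" where
  "Delta_n wp wq z n = U1 wp wq z n + U2 wp z n * U3 wq z n - 2 * U4 wp wq z n"

definition S1 :: "('a::euclidean_space \<Rightarrow> real) \<Rightarrow> ('b::euclidean_space \<Rightarrow> real) \<Rightarrow> ('a \<times> 'b) measure \<Rightarrow> real" where
  "S1 wp wq mu = (LINT z|mu. LINT z1|mu. C_w wp (fst z - fst z1) * C_w wq (snd z - snd z1))"

definition S2 :: "('a::euclidean_space \<Rightarrow> real) \<Rightarrow> ('a \<times> 'b::euclidean_space) measure \<Rightarrow> real" where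
  "S2 wp mu = (LINT z|mu. LINT z1|mu. C_w wp (fst z - fst z1))"

definition S3 :: "('b::euclidean_space \<Rightarrow> real) \<Rightarrow> ('a::euclidean_space \<times> 'b) measure \<Rightarrow> real" where
  "S3 wq mu = (LINT z|mu. LINT z1|mu. C_w wq (snd z - snd z1))"

definition S4 :: "('a::euclidean_space \<Rightarrow> real) \<Rightarrow> ('b::euclidean_space \<Rightarrow> real) \<Rightarrow> ('a \<times> 'b) measure \<Rightarrow> real" where
  "S4 wp wq mu = (LINT z|mu. LINT z1|mu. LINT z2|mu. C_w wp (fst z - fst z1) * C_w wq (snd z - snd z2))"

definition psi4 :: "('a::euclidean_space \<Rightarrow> real) \<Rightarrow> ('b::euclidean_space \<Rightarrow> real) \<Rightarrow>
    'a \<times> 'b \<Rightarrow> 'a \<times> 'b \<Rightarrow> 'a \<times> 'b \<Rightarrow> real" where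
  "psi4 wp wq z z1 z2 = (1/6) *
     (C_w wp (fst z - fst z1) * C_w wq (snd z - snd z2)
    + C_w wp (fst z - fst z2) * C_w wq (snd z - snd z1)
    + C_w wp (fst z - fst z1) * C_w wq (snd z1 - snd z2)
    + C_w wp (fst z1 - fst z2) * C_w wq (snd z - snd z1)
    + C_w wp (fst z - fst z2) * C_w wq (snd z1 - snd z2)
    + C_w wp (fst z1 - fst z2) * C_w wq (snd z - snd z2))"

definition psi1 :: "('a::euclidean_space \<Rightarrow> real) \<Rightarrow> ('b::euclidean_space \<Rightarrow> real) \<Rightarrow>
    ('a \<times> 'b) measure \<Rightarrow> nat \<Rightarrow> 'a \<times> 'b \<Rightarrow> real" where
  "psi1 wp wq mu i z =
     (if i = 1 then (LINT z1|mu. C_w wp (fst z - fst z1) * C_w wq (snd z - snd z1))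
      else if i = 2 then (LINT z1|mu. C_w wp (fst z - fst z1))
      else if i = 3 then (LINT z1|mu. C_w wq (snd z - snd z1))
      else (LINT z1|mu. LINT z2|mu. psi4 wp wq z z1 z2))"

definition zeta1 :: "('a::euclidean_space \<Rightarrow> real) \<Rightarrow> ('b::euclidean_space \<Rightarrow> real) \<Rightarrow>
    ('a \<times> 'b) measure \<Rightarrow> nat \<Rightarrow> nat \<Rightarrow> real" where
  "zeta1 wp wq mu i j =
     (LINT z|mu. psi1 wp wq mu i z * psi1 wp wq mu j z)
     - (LINT z|mu. psi1 wp wq mu i z) * (LINT z|mu. psi1 wp wq mu j z)"

definition m_deg :: "nat \<Rightarrow> real" where
  "m_deg i = (if i = 4 then 3 else 2)"

text \<open>Gradient of h(u) = u1 + u2 u3 - 2 u4 at u = (S1,S2,S3,S4).\<close>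
definition h_grad :: "('a::euclidean_space \<Rightarrow> real) \<Rightarrow> ('b::euclidean_space \<Rightarrow> real) \<Rightarrow>
    ('a \<times> 'b) measure \<Rightarrow> nat \<Rightarrow> real" where
  "h_grad wp wq mu i =
     (if i = 1 then 1 else if i = 2 then S3 wq mu else if i = 3 then S2 wp mu else -2)"

definition sigma2 :: "('a::euclidean_space \<Rightarrow> real) \<Rightarrow> ('b::euclidean_space \<Rightarrow> real) \<Rightarrow>
    ('a \<times> 'b) measure \<Rightarrow> real" where
  "sigma2 wp wq mu = (\<Sum>i\<in>{1..4}. \<Sum>j\<in>{1..4}.
      m_deg i * m_deg j * h_grad wp wq mu i * h_grad wp wq mu j * zeta1 wp wq mu i j)"

definition normal_law :: "real \<Rightarrow> real measure" where
  "normal_law v = (if v = 0 then return borel 0 else density lborel (normal_density 0 (sqrt v)))"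

end

theory Submission
  imports Defs
begin

text \<open>
  Let \<open>W\<close> be the probability measure with density \<open>w\<^sub>p \<otimes> w\<^sub>q\<close>, and let \<open>D\<^sub>N\<close> be the joint minus the
  product of the marginal characteristic functions of a measure \<open>N\<close>, so that the independence
  distance of \<open>N\<close> is \<open>\<integral>|D\<^sub>N|\<^sup>2 dW\<close>. By Fubini it equals \<open>S\<^sub>1 + S\<^sub>2 S\<^sub>3 - 2 S\<^sub>4\<close> for every \<open>N\<close>. Applied to
  the empirical measure, with difference \<open>D\<^sub>n\<close>, this says that the V-statistic version of \<open>\<Delta>\<^sub>n\<close> is
  \<open>\<integral>|D\<^sub>n|\<^sup>2 dW\<close>; it differs from \<open>\<Delta>\<^sub>n\<close> by \<open>O(1/n)\<close> because the kernels are bounded.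

  Expanding \<open>|D\<^sub>n|\<^sup>2\<close> around \<open>|D\<^sub>\<mu>|\<^sup>2\<close> leaves an average of i.i.d. terms \<open>g(Z\<^sub>i)\<close> with
  \<open>g(z) = \<integral> 2 Re(cnj D\<^sub>\<mu> L(z)) dW\<close>, plus a remainder bounded by squared deviations of empirical
  characteristic functions, whose mean is \<open>O(1/n)\<close>. If the distance is \<open>0\<close> then \<open>D\<^sub>\<mu> = 0\<close> \<open>W\<close>-almost
  everywhere (which is weaker than independence where the weights vanish), so \<open>g = 0\<close> and only the
  remainder survives. In general \<open>g = \<Sum>\<^sub>i m\<^sub>i h\<^sub>i' \<psi>\<^sub>1\<^sup>i\<close> up to a constant, so
  its variance is \<open>\<sigma>\<^sup>2\<close>, and the central limit theorem applies; the remainder is removed at the level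
  of characteristic functions through \<open>|E exp(itX) - E exp(itY)| \<le> |t| E|X - Y|\<close>.
\<close>

section \<open>Characteristic functions and weights\<close>

lemma borel_measurable_cis [measurable]: "cis \<in> borel_measurable borel"
  by (intro borel_measurable_continuous_onI continuous_intros)

lemma borel_measurable_cnj [measurable]: "cnj \<in> borel_measurable borel"
  by (intro borel_measurable_continuous_onI continuous_intros)

lemma measurable_fst_borel [measurable]:
  "fst \<in> borel_measurable (borel :: ('a::euclidean_space \<times> 'b::euclidean_space) measure)"
  by (intro borel_measurable_continuous_onI continuous_intros)

lemma measurable_snd_borel [measurable]:
  "snd \<in> borel_measurable (borel :: ('a::euclidean_space \<times> 'b::euclidean_space) measure)"
  by (intro borel_measurable_continuous_onI continuous_intros)

section \<open>Borel probability measures and Fubini for bounded integrands\<close>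

locale borel_prob = prob_space N for N :: "'c::euclidean_space measure" +
  assumes sets_N [simp, measurable_cong]: "sets N = sets borel"
begin

lemma space_N [simp]: "space N = UNIV"
  using sets_eq_imp_space_eq[OF sets_N] by simp

lemma integrable_bounded:
  fixes f :: "'c \<Rightarrow> 'd::{banach, second_countable_topology}"
  assumes "f \<in> borel_measurable borel" "\<And>z. norm (f z) \<le> B"
  shows "integrable N f"
  by (rule integrable_const_bound[of _ B]) (use assms in auto)

end

lemma borel_prob_distr:
  assumes "prob_space M" "f \<in> borel_measurable M"
  shows "borel_prob (distr M borel f)"
  unfolding borel_prob_def borel_prob_axioms_def
  using prob_space.prob_space_distr[OF assms] by simp

lemma borel_prob_return: "borel_prob (return borel z)"
  unfolding borel_prob_def borel_prob_axioms_def
  using prob_space_return[of z borel] by simp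

lemma borel_prob_pair:
  assumes "borel_prob P" "borel_prob Q"
  shows "borel_prob (P \<Otimes>\<^sub>M Q)"
proof -
  interpret P: borel_prob P by fact
  interpret Q: borel_prob Q by fact
  have "sets (P \<Otimes>\<^sub>M Q) = sets (borel \<Otimes>\<^sub>M borel)"
    by (intro sets_pair_measure_cong P.sets_N Q.sets_N)
  also have "\<dots> = sets borel"
    by (simp only: borel_prod)
  finally show ?thesis
    unfolding borel_prob_def borel_prob_axioms_def
    using prob_space_pair[OF P.prob_space_axioms Q.prob_space_axioms] by simp
qed

lemma integral_pair_bounded:
  fixes f :: "'a::euclidean_space \<times> 'b::euclidean_space \<Rightarrow> 'd::{banach, second_countable_topology}"
  assumes "borel_prob P" "borel_prob Q" and f: "f \<in> borel_measurable borel" "\<And>z. norm (f z) \<le> B"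
  shows "(\<integral>z. f z \<partial>(P \<Otimes>\<^sub>M Q)) = (\<integral>x. \<integral>y. f (x, y) \<partial>Q \<partial>P)"
    and "(\<integral>z. f z \<partial>(P \<Otimes>\<^sub>M Q)) = (\<integral>y. \<integral>x. f (x, y) \<partial>P \<partial>Q)"
proof -
  interpret P: borel_prob P by fact
  interpret Q: borel_prob Q by fact
  interpret PQ: borel_prob "P \<Otimes>\<^sub>M Q" by (rule borel_prob_pair) fact+
  interpret pair_sigma_finite P Q ..
  have *: "integrable (P \<Otimes>\<^sub>M Q) f" by (rule PQ.integrable_bounded[OF f])
  show "(\<integral>z. f z \<partial>(P \<Otimes>\<^sub>M Q)) = (\<integral>x. \<integral>y. f (x, y) \<partial>Q \<partial>P)"
    using integral_fst'[OF *] by simp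
  show "(\<integral>z. f z \<partial>(P \<Otimes>\<^sub>M Q)) = (\<integral>y. \<integral>x. f (x, y) \<partial>P \<partial>Q)"
    using integral_snd[of "\<lambda>x y. f (x, y)"] * by simp
qed

section \<open>Characteristic functions in any dimension and the Parseval identity\<close>

definition cf :: "'c::euclidean_space measure \<Rightarrow> 'c \<Rightarrow> complex" where
  "cf N t = (CLINT z|N. cis (t \<bullet> z))"

lemma cf_return [simp]: "cf (return borel z) t = cis (t \<bullet> z)"
  unfolding cf_def by (rule integral_return) auto

context borel_prob
begin

lemma cf_measurable [measurable]: "cf N \<in> borel_measurable borel"
  unfolding cf_def by measurable

lemma norm_cf_le: "norm (cf N t) \<le> 1"
proof -
  have "norm (cf N t) \<le> (\<integral>z. norm (cis (t \<bullet> z)) \<partial>N)"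
    unfolding cf_def by (rule integral_norm_bound)
  then show ?thesis using prob_space by simp
qed

end

lemma cf_pair:
  assumes "borel_prob P" "borel_prob Q"
  shows "cf (P \<Otimes>\<^sub>M Q) (t1, t2) = cf P t1 * cf Q t2"
proof -
  have "cf (P \<Otimes>\<^sub>M Q) (t1, t2) = (\<integral>x. \<integral>y. cis ((t1, t2) \<bullet> (x, y)) \<partial>Q \<partial>P)"
    unfolding cf_def by (rule integral_pair_bounded(1)[OF assms, of _ 1]) auto
  also have "\<dots> = (\<integral>x. cis (t1 \<bullet> x) * cf Q t2 \<partial>P)"
    by (simp add: cf_def flip: cis_mult)
  also have "\<dots> = cf P t1 * cf Q t2"
    by (simp add: cf_def)
  finally show ?thesis .
qed

lemma cf_distr:
  assumes [measurable]: "f \<in> borel_measurable M"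
  shows "cf (distr M borel f) t = (\<integral>\<omega>. cis (t \<bullet> f \<omega>) \<partial>M)"
  unfolding cf_def by (rule integral_distr) auto

text \<open>\<open>cf P t * cnj (cf Q t)\<close> is the mean of
  \<open>cis (t \<bullet> (z - z'))\<close> under \<open>P \<Otimes>\<^sub>M Q\<close>. Integrating
  over \<open>t\<close> first, which boundedness permits, produces \<open>cf W (z - z')\<close>.
  This turns \<open>W\<close>-integrals of characteristic functions into kernel integrals.\<close>

lemma parseval_cf:
  fixes W P Q :: "'c::euclidean_space measure"
  assumes "borel_prob W" "borel_prob P" "borel_prob Q"
  shows "(\<integral>t. cf P t * cnj (cf Q t) \<partial>W) = (\<integral>z. \<integral>z'. cf W (z - z') \<partial>Q \<partial>P)"
proof -
  interpret P: borel_prob P by fact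
  interpret Q: borel_prob Q by fact
  interpret W: borel_prob W by fact
  interpret PQ: borel_prob "P \<Otimes>\<^sub>M Q" by (rule borel_prob_pair) fact+
  have bm: "(\<lambda>p. cis (fst p \<bullet> (fst (snd p) - snd (snd p)))) \<in> borel_measurable (borel :: ('c \<times> 'c \<times> 'c) measure)"
    by (intro borel_measurable_continuous_onI continuous_intros)
  have bm': "(\<lambda>z. cf W (fst z - snd z)) \<in> borel_measurable (borel :: ('c \<times> 'c) measure)"
    by (rule measurable_compose[OF _ W.cf_measurable])
       (intro borel_measurable_continuous_onI continuous_intros)
  have prod: "cf P t * cnj (cf Q t) = (\<integral>z. cis (t \<bullet> (fst z - snd z)) \<partial>(P \<Otimes>\<^sub>M Q))" for t
  proof -
    have "(\<integral>z. cis (t \<bullet> (fst z - snd z)) \<partial>(P \<Otimes>\<^sub>M Q)) = (\<integral>z. \<integral>z'. cis (t \<bullet> (z - z')) \<partial>Q \<partial>P)"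
      by (subst integral_pair_bounded(1)[OF assms(2,3), of _ 1])
         (auto intro!: borel_measurable_continuous_onI continuous_intros)
    also have "\<dots> = (\<integral>z. \<integral>z'. cis (t \<bullet> z) * cnj (cis (t \<bullet> z')) \<partial>Q \<partial>P)"
      by (simp add: inner_diff_right cis_cnj cis_mult)
    also have "\<dots> = cf P t * cnj (cf Q t)"
      unfolding cf_def Bochner_Integration.integral_cnj[symmetric] by simp
    finally show ?thesis by simp
  qed
  have "(\<integral>t. cf P t * cnj (cf Q t) \<partial>W) =
      (\<integral>p. cis (fst p \<bullet> (fst (snd p) - snd (snd p))) \<partial>(W \<Otimes>\<^sub>M (P \<Otimes>\<^sub>M Q)))"
    unfolding prod
    by (subst integral_pair_bounded(1)[OF assms(1) PQ.borel_prob_axioms, of _ 1])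
       (simp_all add: bm)
  also have "\<dots> = (\<integral>z. cf W (fst z - snd z) \<partial>(P \<Otimes>\<^sub>M Q))"
    unfolding cf_def
    by (subst integral_pair_bounded(2)[OF assms(1) PQ.borel_prob_axioms, of _ 1])
       (simp_all add: bm inner_commute)
  also have "\<dots> = (\<integral>z. \<integral>z'. cf W (z - z') \<partial>Q \<partial>P)"
    by (subst integral_pair_bounded(1)[OF assms(2,3), of _ 1]) (simp_all add: W.norm_cf_le bm')
  finally show ?thesis .
qed

section \<open>Weights as probability measures\<close>

definition weight_measure :: "('c::euclidean_space \<Rightarrow> real) \<Rightarrow> 'c measure" where
  "weight_measure w = density lborel (\<lambda>t. ennreal (w t))"

lemma borel_prob_weight_measure:
  assumes "weightA w"
  shows "borel_prob (weight_measure w)"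
proof -
  have w: "w \<in> borel_measurable borel" "\<And>t. 0 \<le> w t" "integrable lborel w" "integral\<^sup>L lborel w = 1"
    using assms by (auto simp: weightA_def)
  have "prob_space (weight_measure w)"
    unfolding weight_measure_def
    by (rule prob_spaceI) (use w in \<open>simp add: emeasure_density nn_integral_eq_integral\<close>)
  then show ?thesis
    by (simp add: borel_prob_def borel_prob_axioms_def weight_measure_def)
qed

lemma integral_lborel_uminus:
  fixes f :: "'c::euclidean_space \<Rightarrow> 'd::{banach, second_countable_topology}"
  assumes "f \<in> borel_measurable borel"
  shows "(\<integral>x. f (- x) \<partial>lborel) = (\<integral>x. f x \<partial>lborel)"
proof -
  have "distr lborel borel uminus = (lborel :: 'c measure)"
    using lborel_affine[of "-1" "0 :: 'c"] by (simp add: density_1)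
  then show ?thesis
    using integral_distr[of uminus lborel borel f] assms by simp
qed

text \<open>Substituting \<open>- t\<close> for \<open>t\<close> and using that \<open>w\<close> is
  even shows that the transform equals its own conjugate, so taking the real part in
  \<open>C_w\<close> loses nothing.\<close>

lemma cf_weight_measure:
  assumes "weightA w"
  shows "cf (weight_measure w) x = complex_of_real (C_w w x)"
proof -
  have w: "w \<in> borel_measurable borel" "\<And>t. 0 \<le> w t" "\<And>t. w (- t) = w t"
    using assms by (auto simp: weightA_def)
  have *: "cf (weight_measure w) x = cf_w w x"
    unfolding cf_def weight_measure_def cf_w_def
    using w by (subst integral_density) (auto simp: scaleR_conv_of_real mult.commute inner_commute)
  have "cnj (cf_w w x) = (\<integral>t. cis (x \<bullet> (- t)) * complex_of_real (w (- t)) \<partial>lborel)"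
    unfolding cf_w_def by (subst Bochner_Integration.integral_cnj[symmetric]) (simp add: cis_cnj w(3))
  also have "\<dots> = cf_w w x"
    unfolding cf_w_def by (rule integral_lborel_uminus) (use w in measurable)
  finally have "cf_w w x \<in> \<real>"
    by (simp add: Reals_cnj_iff)
  then show ?thesis
    unfolding * C_w_def by simp
qed

lemma abs_C_w_le: "weightA w \<Longrightarrow> \<bar>C_w w x\<bar> \<le> 1"
  using borel_prob.norm_cf_le[OF borel_prob_weight_measure, of w x] by (simp add: cf_weight_measure)

lemma C_w_measurable:
  assumes "weightA w"
  shows "C_w w \<in> borel_measurable borel"
proof -
  have "(\<lambda>x. Re (cf (weight_measure w) x)) \<in> borel_measurable borel"
    using borel_prob.cf_measurable[OF borel_prob_weight_measure[OF assms]] by measurable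
  then show ?thesis by (simp add: cf_weight_measure[OF assms])
qed

text \<open>Reflecting the argument conjugates a characteristic function, and this one is real. The
  lemma later aligns kernel arguments in the projection of \<open>psi4\<close>.\<close>

lemma C_w_minus:
  assumes "weightA w"
  shows "C_w w (x - y) = C_w w (y - x)"
proof -
  have "cf (weight_measure w) (- (y - x)) = cnj (cf (weight_measure w) (y - x))"
    unfolding cf_def Bochner_Integration.integral_cnj[symmetric] cis_cnj inner_minus_left ..
  then show ?thesis by (simp add: cf_weight_measure[OF assms])
qed

section \<open>The distance as a quadratic form\<close>

text \<open>Bounds nested integrals without a measurability proof for the inner one.\<close>

lemma (in borel_prob) norm_integral_le:
  fixes f :: "'c \<Rightarrow> 'd::{banach, second_countable_topology}"
  assumes "\<And>z. norm (f z) \<le> B"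
  shows "norm (\<integral>z. f z \<partial>N) \<le> B"
proof (cases "integrable N f")
  case True
  have "norm (\<integral>z. f z \<partial>N) \<le> (\<integral>z. norm (f z) \<partial>N)"
    by (rule integral_norm_bound)
  also have "\<dots> \<le> (\<integral>z. B \<partial>N)"
    using True assms by (intro integral_mono) auto
  finally show ?thesis using prob_space by simp
next
  case False
  \<comment> \<open>The integral of a non-integrable function is 0 by convention, so only the sign
    of \<open>B\<close> matters here.\<close>
  have "0 \<le> B" using assms[of undefined] norm_ge_zero order_trans by blast
  with False show ?thesis by (simp add: not_integrable_integral_eq)
qed

text \<open>The law with the marginals of \<open>N\<close> and independent components.\<close>

definition indep_part :: "('a::euclidean_space \<times> 'b::euclidean_space) measure \<Rightarrow> ('a \<times> 'b) measure" where
  "indep_part N = distr N borel fst \<Otimes>\<^sub>M distr N borel snd"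

lemma borel_prob_marginals:
  fixes N :: "('a::euclidean_space \<times> 'b::euclidean_space) measure"
  assumes "borel_prob N"
  shows "borel_prob (distr N borel fst)" "borel_prob (distr N borel snd)"
proof -
  interpret borel_prob N by fact
  show "borel_prob (distr N borel fst)" "borel_prob (distr N borel snd)"
    by (intro borel_prob_distr prob_space_axioms; measurable)+
qed

lemma borel_prob_indep_part:
  "borel_prob N \<Longrightarrow> borel_prob (indep_part N)"
  unfolding indep_part_def by (intro borel_prob_pair borel_prob_marginals)

section \<open>The weight measure \<open>W\<close> and the distance as a norm in L2(W)\<close>

locale indep_weights =
  fixes wp :: "'a::euclidean_space \<Rightarrow> real" and wq :: "'b::euclidean_space \<Rightarrow> real"
  assumes wp: "weightA wp" and wq: "weightA wq"
begin

definition W :: "('a \<times> 'b) measure" where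
  "W = weight_measure wp \<Otimes>\<^sub>M weight_measure wq"

sublocale W: borel_prob W
  unfolding W_def by (intro borel_prob_pair borel_prob_weight_measure wp wq)

lemma Cp_measurable [measurable]: "C_w wp \<in> borel_measurable borel"
  and Cq_measurable [measurable]: "C_w wq \<in> borel_measurable borel"
  by (intro C_w_measurable wp wq)+

lemma abs_CpCq_le: "\<bar>C_w wp x * C_w wq y\<bar> \<le> 1"
  unfolding abs_mult by (intro mult_le_one abs_C_w_le wp wq) auto

lemma cf_W: "cf W z = complex_of_real (C_w wp (fst z) * C_w wq (snd z))"
  using cf_pair[OF borel_prob_weight_measure[OF wp] borel_prob_weight_measure[OF wq], of "fst z" "snd z"]
  by (simp add: W_def cf_weight_measure wp wq)

text \<open>By Parseval this is the inner product of \<open>cf P\<close> and \<open>cf Q\<close> in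
  L2(W); its kernel is \<open>cf W\<close>.\<close>

definition kerint :: "('a \<times> 'b) measure \<Rightarrow> ('a \<times> 'b) measure \<Rightarrow> real" where
  "kerint P Q = (\<integral>z. \<integral>z'. C_w wp (fst z - fst z') * C_w wq (snd z - snd z') \<partial>Q \<partial>P)"

lemma integrable_cf_cnj:
  assumes "borel_prob P" "borel_prob Q"
  shows "integrable W (\<lambda>t. cf P t * cnj (cf Q t))"
proof -
  interpret P: borel_prob P by fact
  interpret Q: borel_prob Q by fact
  show ?thesis
    by (rule W.integrable_bounded[of _ 1])
       (auto simp: norm_mult intro!: mult_le_one P.norm_cf_le Q.norm_cf_le)
qed

lemma parseval_W:
  assumes "borel_prob P" "borel_prob Q"
  shows "(\<integral>t. cf P t * cnj (cf Q t) \<partial>W) = complex_of_real (kerint P Q)"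
  unfolding parseval_cf[OF W.borel_prob_axioms assms] cf_W kerint_def
  by (simp del: of_real_mult)

text \<open>A product of densities is the density of the product measure, so the weights in
  \<open>indep_dist\<close> are absorbed into \<open>W\<close>.\<close>

lemma integral_W:
  fixes f :: "'a \<times> 'b \<Rightarrow> real"
  assumes "f \<in> borel_measurable borel"
  shows "(\<integral>t. f t \<partial>W) = (\<integral>t. f t * wp (fst t) * wq (snd t) \<partial>(lborel \<Otimes>\<^sub>M lborel))"
proof -
  have [measurable]: "wp \<in> borel_measurable borel" "wq \<in> borel_measurable borel" and
    nn: "0 \<le> wp t" "0 \<le> wq s" for t s
    using wp wq by (auto simp: weightA_def)
  interpret wq: borel_prob "weight_measure wq"
    by (rule borel_prob_weight_measure) (rule wq)
  have "W = density (lborel \<Otimes>\<^sub>M lborel) (\<lambda>(x, y). ennreal (wp x) * ennreal (wq y))"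
    unfolding W_def weight_measure_def
    by (rule pair_measure_density)
       (use wq.sigma_finite_measure_axioms in \<open>auto simp: weight_measure_def lborel.sigma_finite_measure_axioms\<close>)
  also have "\<dots> = density (lborel \<Otimes>\<^sub>M lborel) (\<lambda>t. ennreal (wp (fst t) * wq (snd t)))"
    by (simp add: case_prod_unfold ennreal_mult nn)
  finally have *: "W = \<dots>" .
  have "f \<in> borel_measurable (lborel \<Otimes>\<^sub>M lborel)"
    using assms by (simp add: lborel_prod)
  then show ?thesis
    unfolding * by (subst integral_density) (auto simp: nn mult_ac)
qed

text \<open>The function \<open>D\<^sub>N\<close> of the overview, written as the characteristic
  function of the signed measure \<open>N - indep_part N\<close>, so that it pairs with every
  \<open>cf P\<close> through \<open>kerint\<close>.\<close>

definition dep :: "('a \<times> 'b) measure \<Rightarrow> 'a \<times> 'b \<Rightarrow> complex" where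
  "dep N t = cf N t - cf (indep_part N) t"

lemma dep_measurable [measurable]:
  assumes "borel_prob N"
  shows "dep N \<in> borel_measurable borel"
proof -
  interpret borel_prob N by fact
  interpret I: borel_prob "indep_part N" by (rule borel_prob_indep_part) fact
  show ?thesis unfolding dep_def by measurable
qed

lemma norm_dep_le:
  assumes "borel_prob N"
  shows "norm (dep N t) \<le> 2"
  using borel_prob.norm_cf_le[OF assms, of t]
    borel_prob.norm_cf_le[OF borel_prob_indep_part[OF assms], of t]
  unfolding dep_def by norm

lemma indep_dist_eq_dep:
  assumes "borel_prob N"
  shows "indep_dist wp wq N = (\<integral>t. (cmod (dep N t))\<^sup>2 \<partial>W)"
proof -
  interpret borel_prob N by fact
  have phi: "phi_XY N (fst t) (snd t) = cf N t" for t
    by (simp add: phi_XY_def cf_def inner_prod_def)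
  have X: "phi_X N t = cf (distr N borel fst) t" for t
    unfolding phi_X_def by (rule cf_distr[symmetric]) measurable
  have Y: "phi_Y N t = cf (distr N borel snd) t" for t
    unfolding phi_Y_def by (rule cf_distr[symmetric]) measurable
  have "phi_XY N (fst t) (snd t) - phi_X N (fst t) * phi_Y N (snd t) = dep N t" for t
    using cf_pair[OF borel_prob_marginals[OF assms], of "fst t" "snd t"]
    by (simp add: phi X Y dep_def indep_part_def)
  then show ?thesis
    unfolding indep_dist_def using dep_measurable[OF assms]
    by (subst integral_W) auto
qed

lemma integral_dep:
  assumes N: "borel_prob N" and P: "borel_prob P"
  shows "(\<integral>t. cnj (dep N t) * cf P t \<partial>W) = complex_of_real (kerint P N - kerint P (indep_part N))"
proof -
  interpret N: borel_prob N by fact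
  interpret P: borel_prob P by fact
  interpret I: borel_prob "indep_part N" by (rule borel_prob_indep_part) fact
  have "(\<integral>t. cnj (dep N t) * cf P t \<partial>W) =
      (\<integral>t. cf P t * cnj (cf N t) - cf P t * cnj (cf (indep_part N) t) \<partial>W)"
    by (simp add: dep_def algebra_simps)
  also have "\<dots> = complex_of_real (kerint P N - kerint P (indep_part N))"
    by (subst Bochner_Integration.integral_diff)
       (simp_all add: integrable_cf_cnj parseval_W N.borel_prob_axioms P I.borel_prob_axioms)
  finally show ?thesis .
qed

text \<open>\<open>ap\<close> and \<open>aq\<close> are the potentials of the two marginals under
  the kernels \<open>C_w wp\<close> and \<open>C_w wq\<close>. They are also the projections
  \<open>psi1\<close> with indices 2 and 3.\<close>

definition ap :: "('a \<times> 'b) measure \<Rightarrow> 'a \<Rightarrow> real" where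
  "ap N x = (\<integral>z. C_w wp (x - fst z) \<partial>N)"

definition aq :: "('a \<times> 'b) measure \<Rightarrow> 'b \<Rightarrow> real" where
  "aq N y = (\<integral>z. C_w wq (y - snd z) \<partial>N)"

lemma ap_aq_measurable [measurable]:
  assumes "borel_prob N"
  shows "ap N \<in> borel_measurable borel" "aq N \<in> borel_measurable borel"
proof -
  interpret borel_prob N by fact
  show "ap N \<in> borel_measurable borel" "aq N \<in> borel_measurable borel"
    unfolding ap_def aq_def by measurable
qed

lemma abs_ap_aq_le:
  assumes "borel_prob N"
  shows "\<bar>ap N x\<bar> \<le> 1" "\<bar>aq N y\<bar> \<le> 1"
  using borel_prob.norm_integral_le[OF assms, of "\<lambda>z. C_w wp (x - fst z)" 1]
    borel_prob.norm_integral_le[OF assms, of "\<lambda>z. C_w wq (y - snd z)" 1]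
  by (auto simp: ap_def aq_def abs_C_w_le wp wq)

lemma kerint_indep_part:
  assumes "borel_prob P" "borel_prob N"
  shows "kerint P (indep_part N) = (\<integral>z. ap N (fst z) * aq N (snd z) \<partial>P)"
proof -
  interpret N: borel_prob N by fact
  have "(\<integral>z'. C_w wp (fst z - fst z') * C_w wq (snd z - snd z') \<partial>(indep_part N)) =
      ap N (fst z) * aq N (snd z)" for z
  proof -
    have "(\<integral>z'. C_w wp (fst z - fst z') * C_w wq (snd z - snd z') \<partial>(indep_part N)) =
      (\<integral>x. \<integral>y. C_w wp (fst z - x) * C_w wq (snd z - y) \<partial>(distr N borel snd) \<partial>(distr N borel fst))"
      unfolding indep_part_def
      by (subst integral_pair_bounded(1)[OF borel_prob_marginals[OF assms(2)], of _ 1])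
         (auto simp: abs_CpCq_le)
    also have "\<dots> = ap N (fst z) * aq N (snd z)"
      by (simp add: integral_distr ap_def aq_def)
    finally show ?thesis .
  qed
  then show ?thesis by (simp add: kerint_def)
qed

lemma kerint_prod_indep_part:
  assumes "borel_prob P" "borel_prob Q" "borel_prob N"
  shows "kerint (P \<Otimes>\<^sub>M Q) (indep_part N) = (\<integral>x. ap N x \<partial>P) * (\<integral>y. aq N y \<partial>Q)"
proof -
  note [measurable] = ap_aq_measurable[OF assms(3)]
  have "\<bar>ap N x * aq N y\<bar> \<le> 1" for x y
    unfolding abs_mult by (intro mult_le_one abs_ap_aq_le assms) auto
  then have "(\<integral>z. ap N (fst z) * aq N (snd z) \<partial>(P \<Otimes>\<^sub>M Q)) = (\<integral>x. \<integral>y. ap N x * aq N y \<partial>Q \<partial>P)"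
    by (subst integral_pair_bounded(1)[OF assms(1,2), of _ 1]) auto
  then show ?thesis
    by (simp add: kerint_indep_part[OF borel_prob_pair[OF assms(1,2)] assms(3)])
qed

text \<open>The Gram matrix of \<open>cf N\<close> and \<open>cf (indep_part N)\<close> in L2(W).
  Integrating over a product measure factorizes the kernel: doing so once gives \<open>S4\<close>,
  doing so in both arguments gives \<open>S2 * S3\<close>.\<close>

lemma kerint_S:
  assumes "borel_prob N"
  shows "kerint N N = S1 wp wq N" "kerint N (indep_part N) = S4 wp wq N"
    "kerint (indep_part N) (indep_part N) = S2 wp N * S3 wq N"
proof -
  interpret N: borel_prob N by fact
  note [measurable] = ap_aq_measurable[OF assms]
  show "kerint N N = S1 wp wq N" by (simp add: kerint_def S1_def)
  show "kerint N (indep_part N) = S4 wp wq N"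
    unfolding kerint_indep_part[OF assms assms] S4_def by (simp add: ap_def aq_def)
  show "kerint (indep_part N) (indep_part N) = S2 wp N * S3 wq N"
    \<comment> \<open>Only the first argument is unfolded into a product; the second stays folded to
      match \<open>kerint_prod_indep_part\<close>.\<close>
    by (subst (1) indep_part_def)
       (simp add: kerint_prod_indep_part borel_prob_marginals assms integral_distr S2_def S3_def
          flip: ap_def aq_def)
qed

text \<open>Expanding the squared norm of a difference leaves the three inner products of
  \<open>kerint_S\<close>.\<close>

lemma indep_dist_eq_S:
  assumes "borel_prob N"
  shows "indep_dist wp wq N = S1 wp wq N + S2 wp N * S3 wq N - 2 * S4 wp wq N"
proof -
  interpret N: borel_prob N by fact
  interpret I: borel_prob "indep_part N" by (rule borel_prob_indep_part) fact
  have int: "integrable W (\<lambda>t. Re (cf P t * cnj (cf Q t)))"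
    and eq: "(\<integral>t. Re (cf P t * cnj (cf Q t)) \<partial>W) = kerint P Q"
    if "borel_prob P" "borel_prob Q" for P Q
    using integrable_Re[OF integrable_cf_cnj[OF that]] integral_Re[OF integrable_cf_cnj[OF that]]
    by (simp_all add: parseval_W[OF that])
  have "(cmod (dep N t))\<^sup>2 = Re (cf N t * cnj (cf N t)) - 2 * Re (cf N t * cnj (cf (indep_part N) t))
      + Re (cf (indep_part N) t * cnj (cf (indep_part N) t))" for t
    unfolding dep_def cmod_power2 by (simp add: power2_eq_square algebra_simps)
  then have "indep_dist wp wq N = kerint N N - 2 * kerint N (indep_part N)
      + kerint (indep_part N) (indep_part N)"
    unfolding indep_dist_eq_dep[OF assms]
    by (simp add: int eq N.borel_prob_axioms I.borel_prob_axioms del: times_complex.sel complex_cnj)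
  then show ?thesis by (simp add: kerint_S[OF assms])
qed

end

section \<open>Linearization\<close>

text \<open>A first-order expansion with explicit error. The expression is polynomial, so the error
  consists of the quadratic term of the squared norm and the bilinear term of the product
  \<open>a * b\<close>, the latter weighted by the old difference.\<close>

lemma norm_sq_product_expansion:
  fixes a b c a0 b0 c0 :: complex
  assumes "norm b \<le> 1" "norm a0 \<le> 1" "norm (c0 - a0 * b0) \<le> 2"
  shows "\<bar>(norm (c - a * b))\<^sup>2 - (norm (c0 - a0 * b0))\<^sup>2
      - 2 * Re (cnj (c0 - a0 * b0) * (c - c0 - (a - a0) * b0 - a0 * (b - b0)))\<bar>
    \<le> 5 * ((norm (c - c0))\<^sup>2 + (norm (a - a0))\<^sup>2 + (norm (b - b0))\<^sup>2)"
proof -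
  define d where "d = c - a * b"
  define d0 where "d0 = c0 - a0 * b0"
  define A where "A = a - a0"
  define B where "B = b - b0"
  define C where "C = c - c0"
  have sq: "(norm d)\<^sup>2 - (norm d0)\<^sup>2 = 2 * Re (cnj d0 * (d - d0)) + (norm (d - d0))\<^sup>2"
    unfolding cmod_power2 by (simp add: power2_eq_square algebra_simps)
  \<comment> \<open>The linear part misses the increment of \<open>c - a * b\<close> only by the
    bilinear term \<open>A * B\<close>.\<close>
  have lin: "C - A * b0 - a0 * B = (d - d0) + A * B"
    by (simp add: A_def B_def C_def d_def d0_def algebra_simps)
  have eq: "(norm d)\<^sup>2 - (norm d0)\<^sup>2 - 2 * Re (cnj d0 * (C - A * b0 - a0 * B))
      = (norm (d - d0))\<^sup>2 - 2 * Re (cnj d0 * (A * B))"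
    unfolding sq lin distrib_left plus_complex.sel by simp
  \<comment> \<open>Pairing the new \<open>b\<close> with the old \<open>a0\<close> makes this
    decomposition exact; the bounds on \<open>b\<close> and \<open>a0\<close> enter here.\<close>
  have "d - d0 = C - A * b - a0 * B"
    by (simp add: A_def B_def C_def d_def d0_def algebra_simps)
  then have "norm (d - d0) \<le> norm C + norm A * norm b + norm a0 * norm B"
    using norm_triangle_ineq4[of "C - A * b" "a0 * B"] norm_triangle_ineq4[of C "A * b"]
    by (simp add: norm_mult)
  also have "\<dots> \<le> norm C + norm A + norm B"
    using mult_left_mono[OF assms(1), of "norm A"] mult_right_mono[OF assms(2), of "norm B"] by simp
  finally have "(norm (d - d0))\<^sup>2 \<le> (norm C + norm A + norm B)\<^sup>2"
    by (intro power_mono) auto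
  also have "\<dots> \<le> 3 * ((norm C)\<^sup>2 + (norm A)\<^sup>2 + (norm B)\<^sup>2)"
    using sum_squares_bound[of "norm C" "norm A"] sum_squares_bound[of "norm C" "norm B"]
      sum_squares_bound[of "norm A" "norm B"]
    by (simp add: power2_eq_square algebra_simps)
  finally have 1: "(norm (d - d0))\<^sup>2 \<le> 3 * ((norm C)\<^sup>2 + (norm A)\<^sup>2 + (norm B)\<^sup>2)" .
  have "\<bar>Re (cnj d0 * (A * B))\<bar> \<le> norm d0 * (norm A * norm B)"
    using abs_Re_le_cmod[of "cnj d0 * (A * B)"] by (simp add: norm_mult)
  also have "\<dots> \<le> 2 * (norm A * norm B)"
    using assms(3) by (intro mult_right_mono) (auto simp: d0_def)
  also have "\<dots> \<le> (norm A)\<^sup>2 + (norm B)\<^sup>2"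
    using sum_squares_bound[of "norm A" "norm B"] by (simp add: mult.assoc)
  finally have 2: "\<bar>Re (cnj d0 * (A * B))\<bar> \<le> (norm A)\<^sup>2 + (norm B)\<^sup>2" .
  \<comment> \<open>In the constant 5, 3 comes from squaring a sum of three terms and 2 from the
    doubled bilinear term.\<close>
  have arith: "\<bar>x - 2 * y\<bar> \<le> 5 * (p + q + r)"
    if "x \<le> 3 * (p + q + r)" "\<bar>y\<bar> \<le> q + r" "0 \<le> x" "0 \<le> p" "0 \<le> q" "0 \<le> r" for x y p q r :: real
    using that unfolding abs_le_iff by auto
  have "\<bar>(norm d)\<^sup>2 - (norm d0)\<^sup>2 - 2 * Re (cnj d0 * (C - A * b0 - a0 * B))\<bar>
    \<le> 5 * ((norm C)\<^sup>2 + (norm A)\<^sup>2 + (norm B)\<^sup>2)"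
    unfolding eq by (rule arith[OF 1 2]) auto
  then show ?thesis by (simp only: A_def B_def C_def d_def d0_def)
qed

section \<open>The influence function of the distance at \<open>mu\<close>\<close>

locale indep_setup = indep_weights wp wq + mu: borel_prob mu
  for wp :: "'a::euclidean_space \<Rightarrow> real" and wq :: "'b::euclidean_space \<Rightarrow> real"
    and mu :: "('a \<times> 'b) measure"
begin

definition muX :: "'a measure" where "muX = distr mu borel fst"
definition muY :: "'b measure" where "muY = distr mu borel snd"

sublocale muX: borel_prob muX
  unfolding muX_def by (rule borel_prob_marginals mu.borel_prob_axioms)+
sublocale muY: borel_prob muY
  unfolding muY_def by (rule borel_prob_marginals mu.borel_prob_axioms)+
sublocale muI: borel_prob "indep_part mu"
  by (rule borel_prob_indep_part mu.borel_prob_axioms)+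

lemma indep_part_mu: "indep_part mu = muX \<Otimes>\<^sub>M muY"
  by (simp add: indep_part_def muX_def muY_def)

lemma cf_indep_part: "cf (indep_part mu) t = cf muX (fst t) * cf muY (snd t)"
  using cf_pair[OF muX.borel_prob_axioms muY.borel_prob_axioms, of "fst t" "snd t"]
  by (simp add: indep_part_mu)

lemmas [measurable] = dep_measurable[OF mu.borel_prob_axioms] ap_aq_measurable[OF mu.borel_prob_axioms]

definition lin :: "'a \<times> 'b \<Rightarrow> 'a \<times> 'b \<Rightarrow> complex" where
  "lin t z = cis (t \<bullet> z) - cf mu t - (cis (fst t \<bullet> fst z) - cf muX (fst t)) * cf muY (snd t)
      - cf muX (fst t) * (cis (snd t \<bullet> snd z) - cf muY (snd t))"

text \<open>\<open>lin t\<close> linearizes \<open>N \<mapsto> dep N t\<close> at \<open>mu\<close>, so \<open>infl\<close> is the influence function of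
  \<open>N \<mapsto> indep_dist wp wq N\<close> at \<open>mu\<close>.\<close>
definition infl :: "'a \<times> 'b \<Rightarrow> real" where
  "infl z = (\<integral>t. 2 * Re (cnj (dep mu t) * lin t z) \<partial>W)"

lemma norm_lin_le: "norm (lin t z) \<le> 6"
proof -
  have 1: "norm (cis (t \<bullet> z) - cf mu t) \<le> 2"
    using mu.norm_cf_le[of t] norm_triangle_ineq4[of "cis (t \<bullet> z)" "cf mu t"] by simp
  have 2: "norm (cis (fst t \<bullet> fst z) - cf muX (fst t)) \<le> 2"
    using muX.norm_cf_le[of "fst t"] norm_triangle_ineq4[of "cis (fst t \<bullet> fst z)" "cf muX (fst t)"] by simp
  have 3: "norm (cis (snd t \<bullet> snd z) - cf muY (snd t)) \<le> 2"
    using muY.norm_cf_le[of "snd t"] norm_triangle_ineq4[of "cis (snd t \<bullet> snd z)" "cf muY (snd t)"] by simp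
  have 4: "norm ((cis (fst t \<bullet> fst z) - cf muX (fst t)) * cf muY (snd t)) \<le> 2 * 1"
    unfolding norm_mult by (intro mult_mono 2 muY.norm_cf_le) auto
  have 5: "norm (cf muX (fst t) * (cis (snd t \<bullet> snd z) - cf muY (snd t))) \<le> 1 * 2"
    unfolding norm_mult by (intro mult_mono 3 muX.norm_cf_le) auto
  show ?thesis
    using 1 4 5 unfolding lin_def by norm
qed

lemma abs_infl_integrand_le: "\<bar>2 * Re (cnj (dep mu t) * lin t z)\<bar> \<le> 24"
proof -
  have "\<bar>Re (cnj (dep mu t) * lin t z)\<bar> \<le> norm (dep mu t) * norm (lin t z)"
    using abs_Re_le_cmod[of "cnj (dep mu t) * lin t z"] by (simp add: norm_mult)
  also have "\<dots> \<le> 2 * 6"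
    by (intro mult_mono norm_lin_le norm_dep_le mu.borel_prob_axioms) auto
  finally show ?thesis by simp
qed

lemma infl_integrand_measurable:
  "(\<lambda>p. 2 * Re (cnj (dep mu (snd p)) * lin (snd p) (fst p))) \<in> borel_measurable borel"
  unfolding lin_def by measurable

lemma infl_measurable [measurable]: "infl \<in> borel_measurable borel"
proof -
  have "(\<lambda>p. 2 * Re (cnj (dep mu (snd p)) * lin (snd p) (fst p))) \<in> borel_measurable (borel \<Otimes>\<^sub>M W)"
    using infl_integrand_measurable
    by (simp add: borel_prod[symmetric] cong: measurable_cong_sets sets_pair_measure_cong)
  then show ?thesis
    unfolding infl_def by (intro W.borel_measurable_lebesgue_integral) (simp add: case_prod_unfold)
qed

lemma abs_infl_le: "\<bar>infl z\<bar> \<le> 24"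
  unfolding infl_def
  using W.norm_integral_le[of "\<lambda>t. 2 * Re (cnj (dep mu t) * lin t z)" 24] abs_infl_integrand_le by simp

text \<open>The mean of \<open>lin t\<close> over \<open>N\<close>, which is the derivative of
  \<open>dep\<close> at \<open>mu\<close> in the direction \<open>N - mu\<close>.\<close>

definition lin_measure :: "('a \<times> 'b) measure \<Rightarrow> 'a \<times> 'b \<Rightarrow> complex" where
  "lin_measure N t = cf N t - cf mu t - (cf (distr N borel fst) (fst t) - cf muX (fst t)) * cf muY (snd t)
      - cf muX (fst t) * (cf (distr N borel snd) (snd t) - cf muY (snd t))"

text \<open>\<open>lin t z\<close> is affine in three exponentials of \<open>z\<close>, so averaging
  over \<open>N\<close> replaces each of them by a characteristic function, and Fubini exchanges
  \<open>N\<close> and \<open>W\<close>. For an empirical measure the left side is the average of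
  the terms \<open>infl (Z i)\<close>.\<close>

lemma integral_infl:
  assumes "borel_prob N"
  shows "(\<integral>z. infl z \<partial>N) = (\<integral>t. 2 * Re (cnj (dep mu t) * lin_measure N t) \<partial>W)"
proof -
  interpret N: borel_prob N by fact
  have int: "integrable N (\<lambda>z. cis (t \<bullet> z))" "integrable N (\<lambda>z. cis (fst t \<bullet> fst z))"
    "integrable N (\<lambda>z. cis (snd t \<bullet> snd z))" for t
    by (auto intro!: N.integrable_bounded[of _ 1])
  have lin: "(\<integral>z. lin t z \<partial>N) = lin_measure N t" for t
    unfolding lin_def lin_measure_def
    using N.prob_space by (simp add: int cf_distr) (simp add: cf_def)
  have intl: "integrable N (lin t)" for t
    unfolding lin_def by (intro Bochner_Integration.integrable_diff integrable_mult_left integrable_mult_right int) auto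
  have int_lin: "(\<integral>z. 2 * Re (cnj (dep mu t) * lin t z) \<partial>N) = 2 * Re (cnj (dep mu t) * lin_measure N t)" for t
    using intl[of t] by (simp add: integral_Re del: times_complex.sel flip: lin)
  have "(\<integral>z. infl z \<partial>N) = (\<integral>t. \<integral>z. 2 * Re (cnj (dep mu t) * lin t z) \<partial>N \<partial>W)"
    unfolding infl_def
    using integral_pair_bounded[OF assms W.borel_prob_axioms infl_integrand_measurable, of 24]
      abs_infl_integrand_le by simp
  then show ?thesis by (simp only: int_lin)
qed

lemma integral_infl_mu: "(\<integral>z. infl z \<partial>mu) = 0"
  unfolding integral_infl[OF mu.borel_prob_axioms] lin_measure_def muX_def muY_def by simp

text \<open>Integrates \<open>norm_sq_product_expansion\<close> over \<open>W\<close>, with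
  \<open>c\<close> the joint and \<open>a\<close>, \<open>b\<close> the marginal characteristic
  functions of \<open>N\<close>. The estimate is deterministic; randomness enters once
  \<open>N\<close> is empirical.\<close>

lemma indep_dist_linearization:
  assumes "borel_prob N"
  shows "\<bar>indep_dist wp wq N - indep_dist wp wq mu - (\<integral>z. infl z \<partial>N)\<bar>
    \<le> 5 * (\<integral>t. (cmod (cf N t - cf mu t))\<^sup>2
          + (cmod (cf (distr N borel fst) (fst t) - cf muX (fst t)))\<^sup>2
          + (cmod (cf (distr N borel snd) (snd t) - cf muY (snd t)))\<^sup>2 \<partial>W)"
    (is "_ \<le> 5 * (\<integral>t. ?R t \<partial>W)")
proof -
  interpret N: borel_prob N by fact
  interpret NX: borel_prob "distr N borel fst" by (rule borel_prob_marginals) fact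
  interpret NY: borel_prob "distr N borel snd" by (rule borel_prob_marginals) fact
  \<comment> \<open>Stated for an arbitrary space, since it is applied to the pair and to both
    marginals.\<close>
  have cf_le: "cmod (cf P s - cf Q s) \<le> 2" if "borel_prob P" "borel_prob Q"
    for P Q :: "'x::euclidean_space measure" and s
    using norm_triangle_ineq4[of "cf P s" "cf Q s"] borel_prob.norm_cf_le[OF that(1), of s]
      borel_prob.norm_cf_le[OF that(2), of s] by simp
  have sq_le: "x\<^sup>2 \<le> 4" if "0 \<le> x" "x \<le> 2" for x :: real
    using power_mono[OF that(2,1), of 2] by simp
  note bp = N.borel_prob_axioms NX.borel_prob_axioms NY.borel_prob_axioms mu.borel_prob_axioms
    muX.borel_prob_axioms muY.borel_prob_axioms
  have "\<bar>?R t\<bar> \<le> 12" for t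
    using sq_le[OF norm_ge_zero cf_le[OF bp(1,4), of t]] sq_le[OF norm_ge_zero cf_le[OF bp(2,5), of "fst t"]]
      sq_le[OF norm_ge_zero cf_le[OF bp(3,6), of "snd t"]] by simp
  then have intR: "integrable W ?R"
    by (intro W.integrable_bounded[of _ 12]) auto
  have intd: "integrable W (\<lambda>t. (cmod (dep P t))\<^sup>2)" if "borel_prob P" for P
    using sq_le[OF norm_ge_zero norm_dep_le[OF that]] dep_measurable[OF that]
    by (intro W.integrable_bounded[of _ 4]) auto
  have "norm (lin_measure N t) \<le> 6" for t
  proof -
    have "norm ((cf (distr N borel fst) (fst t) - cf muX (fst t)) * cf muY (snd t)) \<le> 2 * 1"
      unfolding norm_mult by (intro mult_mono cf_le bp muY.norm_cf_le) auto
    moreover have "norm (cf muX (fst t) * (cf (distr N borel snd) (snd t) - cf muY (snd t))) \<le> 1 * 2"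
      unfolding norm_mult by (intro mult_mono cf_le bp muX.norm_cf_le) auto
    ultimately show ?thesis
      using cf_le[OF bp(1,4), of t] unfolding lin_measure_def by norm
  qed
  then have "norm (dep mu t) * norm (lin_measure N t) \<le> 2 * 6" for t
    by (intro mult_mono norm_dep_le bp) auto
  then have "\<bar>2 * Re (cnj (dep mu t) * lin_measure N t)\<bar> \<le> 24" for t
    using abs_Re_le_cmod[of "cnj (dep mu t) * lin_measure N t"]
    by (simp add: norm_mult del: times_complex.sel) (smt (verit))
  then have intl: "integrable W (\<lambda>t. 2 * Re (cnj (dep mu t) * lin_measure N t))"
    unfolding lin_measure_def by (intro W.integrable_bounded[of _ 24]) auto
  have depN: "dep N t = cf N t - cf (distr N borel fst) (fst t) * cf (distr N borel snd) (snd t)" for t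
    using cf_pair[OF bp(2,3), of "fst t" "snd t"] by (simp add: dep_def indep_part_def)
  have depmu: "dep mu t = cf mu t - cf muX (fst t) * cf muY (snd t)" for t
    by (simp add: dep_def cf_indep_part)
  have pt: "\<bar>(cmod (dep N t))\<^sup>2 - (cmod (dep mu t))\<^sup>2 - 2 * Re (cnj (dep mu t) * lin_measure N t)\<bar> \<le> 5 * ?R t" for t
    using norm_sq_product_expansion[OF NY.norm_cf_le muX.norm_cf_le, of "cf mu t" "fst t" "cf muY (snd t)" "cf N t"
        "cf (distr N borel fst) (fst t)" "snd t"] norm_dep_le[OF mu.borel_prob_axioms, of t]
    unfolding depN depmu lin_measure_def by blast
  have "indep_dist wp wq N - indep_dist wp wq mu - (\<integral>z. infl z \<partial>N) =
      (\<integral>t. (cmod (dep N t))\<^sup>2 - (cmod (dep mu t))\<^sup>2 - 2 * Re (cnj (dep mu t) * lin_measure N t) \<partial>W)"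
    unfolding indep_dist_eq_dep[OF assms] indep_dist_eq_dep[OF mu.borel_prob_axioms] integral_infl[OF assms]
    unfolding Bochner_Integration.integral_diff[OF Bochner_Integration.integrable_diff[OF intd[OF bp(1)] intd[OF bp(4)]] intl]
      Bochner_Integration.integral_diff[OF intd[OF bp(1)] intd[OF bp(4)]] ..
  also have "\<bar>\<dots>\<bar> \<le> (\<integral>t. \<bar>(cmod (dep N t))\<^sup>2 - (cmod (dep mu t))\<^sup>2 - 2 * Re (cnj (dep mu t) * lin_measure N t)\<bar> \<partial>W)"
    by (rule integral_abs_bound)
  also have "\<dots> \<le> (\<integral>t. 5 * ?R t \<partial>W)"
    by (intro integral_mono integrable_abs Bochner_Integration.integrable_diff intd bp intl
        integrable_mult_right intR pt)
  also have "\<dots> = 5 * (\<integral>t. ?R t \<partial>W)"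
    by (rule integral_mult_right_zero)
  finally show ?thesis .
qed

text \<open>A zero distance makes \<open>dep mu\<close> vanish \<open>W\<close>-almost everywhere,
  and \<open>infl z\<close> integrates a multiple of it against \<open>W\<close>; this yields the
  claim at every point \<open>z\<close>.\<close>

lemma infl_eq_0:
  assumes "indep_dist wp wq mu = 0"
  shows "infl z = 0"
proof -
  have sq: "(cmod (dep mu t))\<^sup>2 \<le> 4" for t
    using power_mono[OF norm_dep_le[OF mu.borel_prob_axioms, of t], of 2] by simp
  have "integrable W (\<lambda>t. (cmod (dep mu t))\<^sup>2)"
    by (rule W.integrable_bounded[of _ 4]) (use sq in auto)
  then have "AE t in W. (cmod (dep mu t))\<^sup>2 = 0"
    using integral_nonneg_eq_0_iff_AE[of W "\<lambda>t. (cmod (dep mu t))\<^sup>2"] assms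
      indep_dist_eq_dep[OF mu.borel_prob_axioms] by simp
  then have "AE t in W. 2 * Re (cnj (dep mu t) * lin t z) = 0"
    by eventually_elim simp
  then show ?thesis
    unfolding infl_def by (rule integral_eq_zero_AE)
qed

end

section \<open>The influence function and the limiting variance\<close>

context indep_setup
begin

text \<open>In \<open>cp\<close> the first coordinate is frozen at \<open>x\<close> and the second
  is drawn separately, as under \<open>return borel x \<Otimes>\<^sub>M muY\<close>;
  \<open>cq\<close> exchanges the roles. They are the projections of those summands of
  \<open>psi4\<close> in which only one coordinate of \<open>z\<close> occurs.\<close>

definition cp :: "'a \<Rightarrow> real" where
  "cp x = (\<integral>z2. \<integral>z1. C_w wp (x - fst z1) * C_w wq (snd z2 - snd z1) \<partial>mu \<partial>mu)"

definition cq :: "'b \<Rightarrow> real" where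
  "cq y = (\<integral>z2. \<integral>z1. C_w wp (fst z2 - fst z1) * C_w wq (y - snd z1) \<partial>mu \<partial>mu)"

text \<open>This and the next two lemmas evaluate \<open>kerint\<close> at the
  \<open>z\<close>-dependent measures that occur in \<open>lin_eq_cf\<close>.\<close>

lemma kerint_return:
  "kerint (return borel z) mu = psi1 wp wq mu 1 z"
  "kerint (return borel z) (indep_part mu) = ap mu (fst z) * aq mu (snd z)"
proof -
  show "kerint (return borel z) mu = psi1 wp wq mu 1 z"
    unfolding kerint_def psi1_def by (subst integral_return) auto
  show "kerint (return borel z) (indep_part mu) = ap mu (fst z) * aq mu (snd z)"
    unfolding kerint_indep_part[OF borel_prob_return mu.borel_prob_axioms]
    by (subst integral_return) auto
qed

lemma kerint_return_muY:
  "kerint (return borel x \<Otimes>\<^sub>M muY) mu = cp x"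
  "kerint (return borel x \<Otimes>\<^sub>M muY) (indep_part mu) = ap mu x * S3 wq mu"
proof -
  let ?f = "\<lambda>z. \<integral>z'. C_w wp (fst z - fst z') * C_w wq (snd z - snd z') \<partial>mu"
  have "\<bar>?f z\<bar> \<le> 1" for z
    using mu.norm_integral_le[of "\<lambda>z'. C_w wp (fst z - fst z') * C_w wq (snd z - snd z')" 1]
    by (simp add: abs_CpCq_le)
  then show "kerint (return borel x \<Otimes>\<^sub>M muY) mu = cp x"
    unfolding kerint_def
    \<comment> \<open>This order puts the point mass inside, and the remaining outer variable
      becomes the outer variable of \<open>cp\<close>.\<close>
    by (subst integral_pair_bounded(2)[OF borel_prob_return muY.borel_prob_axioms, of _ 1])
       (auto simp: integral_return muY_def integral_distr cp_def)
  show "kerint (return borel x \<Otimes>\<^sub>M muY) (indep_part mu) = ap mu x * S3 wq mu"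
    unfolding kerint_prod_indep_part[OF borel_prob_return muY.borel_prob_axioms mu.borel_prob_axioms]
    by (simp add: integral_return muY_def integral_distr S3_def flip: aq_def)
qed

lemma kerint_muX_return:
  "kerint (muX \<Otimes>\<^sub>M return borel y) mu = cq y"
  "kerint (muX \<Otimes>\<^sub>M return borel y) (indep_part mu) = S2 wp mu * aq mu y"
proof -
  let ?f = "\<lambda>z. \<integral>z'. C_w wp (fst z - fst z') * C_w wq (snd z - snd z') \<partial>mu"
  have "\<bar>?f z\<bar> \<le> 1" for z
    using mu.norm_integral_le[of "\<lambda>z'. C_w wp (fst z - fst z') * C_w wq (snd z - snd z')" 1]
    by (simp add: abs_CpCq_le)
  then show "kerint (muX \<Otimes>\<^sub>M return borel y) mu = cq y"
    unfolding kerint_def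
    by (subst integral_pair_bounded(1)[OF muX.borel_prob_axioms borel_prob_return, of _ 1])
       (auto simp: integral_return muX_def integral_distr cq_def)
  show "kerint (muX \<Otimes>\<^sub>M return borel y) (indep_part mu) = S2 wp mu * aq mu y"
    unfolding kerint_prod_indep_part[OF muX.borel_prob_axioms borel_prob_return mu.borel_prob_axioms]
    by (simp add: integral_return muX_def integral_distr S2_def flip: ap_def)
qed

text \<open>Writes \<open>lin\<close> as a combination of characteristic functions of probability
  measures, each of which \<open>integral_dep\<close> can handle. The factor 2 arises because each
  of the two marginal corrections contributes one product of the marginals.\<close>

lemma lin_eq_cf:
  "lin t z = cf (return borel z) t - cf mu t - cf (return borel (fst z) \<Otimes>\<^sub>M muY) t
      - cf (muX \<Otimes>\<^sub>M return borel (snd z)) t + 2 * cf (indep_part mu) t"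
  using cf_pair[OF borel_prob_return muY.borel_prob_axioms, of "fst z" "fst t" "snd t"]
    cf_pair[OF muX.borel_prob_axioms borel_prob_return, of "snd z" "fst t" "snd t"]
  by (simp add: lin_def cf_indep_part algebra_simps)

text \<open>The index 1 appears as \<open>Suc 0\<close>, the form to which the simplifier reduces
  it.\<close>

lemma psi1_simps:
  "psi1 wp wq mu (Suc 0) z = (\<integral>z1. C_w wp (fst z - fst z1) * C_w wq (snd z - snd z1) \<partial>mu)"
  "psi1 wp wq mu 2 z = ap mu (fst z)"
  "psi1 wp wq mu 3 z = aq mu (snd z)"
  by (simp_all add: psi1_def ap_def aq_def)

text \<open>Of the six permuted summands two project to the product of the potentials, two to
  \<open>cp\<close> and two to \<open>cq\<close>. Hence the denominator 3, which
  \<open>m_deg 4\<close> later cancels.\<close>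

lemma psi1_4: "psi1 wp wq mu 4 z = (ap mu (fst z) * aq mu (snd z) + cp (fst z) + cq (snd z)) / 3"
proof -
  obtain x y where z: "z = (x, y)" by (cases z)
  let ?C = "C_w wp" and ?D = "C_w wq"
  interpret mm: borel_prob "mu \<Otimes>\<^sub>M mu"
    by (intro borel_prob_pair mu.borel_prob_axioms)
  \<comment> \<open>Indexing the summands lets measurability, boundedness and Fubini be proved once
    for all six.\<close>
  define f where "f i p = (let x1 = fst (fst p); y1 = snd (fst p); x2 = fst (snd p); y2 = snd (snd p) in
     if i = 1 then ?C (x - x1) * ?D (y - y2)
     else if i = 2 then ?C (x - x2) * ?D (y - y1)
     else if i = 3 then ?C (x - x1) * ?D (y1 - y2)
     else if i = 4 then ?C (x1 - x2) * ?D (y - y1)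
     else if i = 5 then ?C (x - x2) * ?D (y1 - y2)
     else ?C (x1 - x2) * ?D (y - y2))" for i :: nat and p :: "('a \<times> 'b) \<times> ('a \<times> 'b)"
  have meas: "f i \<in> borel_measurable borel" for i
    unfolding f_def Let_def by measurable
  have bd: "\<bar>f i p\<bar> \<le> 1" for i p
    unfolding f_def Let_def by (auto simp: abs_CpCq_le)
  define I where "I i = (\<integral>p. f i p \<partial>(mu \<Otimes>\<^sub>M mu))" for i
  \<comment> \<open>Both orders of integration are kept; each summand below uses the one that
    matches its target after renaming.\<close>
  have I: "I i = (\<integral>z1. \<integral>z2. f i (z1, z2) \<partial>mu \<partial>mu)" "I i = (\<integral>z2. \<integral>z1. f i (z1, z2) \<partial>mu \<partial>mu)" for i
    unfolding I_def using integral_pair_bounded[OF mu.borel_prob_axioms mu.borel_prob_axioms meas[of i], where B=1] bd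
    by simp_all
  have int: "integrable (mu \<Otimes>\<^sub>M mu) (f i)" for i
    by (rule mm.integrable_bounded[OF meas, of _ 1]) (simp add: bd)
  define h where "h p = (1/6) * (f 1 p + f 2 p + f 3 p + f 4 p + f 5 p + f 6 p)" for p
  have psi4: "psi4 wp wq z z1 z2 = h (z1, z2)" for z1 z2
    by (simp add: psi4_def h_def f_def z)
  have "psi1 wp wq mu 4 z = (\<integral>z1. \<integral>z2. h (z1, z2) \<partial>mu \<partial>mu)"
    by (simp add: psi1_def flip: psi4)
  also have "\<dots> = (\<integral>p. h p \<partial>(mu \<Otimes>\<^sub>M mu))"
  proof (rule integral_pair_bounded(1)[symmetric, OF mu.borel_prob_axioms mu.borel_prob_axioms, of _ 1])
    show "h \<in> borel_measurable borel" unfolding h_def using meas by measurable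
    show "norm (h p) \<le> 1" for p
      using bd[of 1 p] bd[of 2 p] bd[of 3 p] bd[of 4 p] bd[of 5 p] bd[of 6 p] by (simp add: h_def)
  qed
  also have "\<dots> = (1/6) * (I 1 + I 2 + I 3 + I 4 + I 5 + I 6)"
    unfolding h_def I_def by (simp add: int)
  also have "I 1 = ap mu x * aq mu y"
    unfolding I(1) by (simp add: f_def ap_def aq_def)
  also have "I 2 = ap mu x * aq mu y"
    unfolding I(2) by (simp add: f_def ap_def aq_def)
  also have "I 3 = cp x"
    unfolding I(2) by (simp add: f_def cp_def C_w_minus[OF wq])
  also have "I 4 = cq y"
    unfolding I(2) by (simp add: f_def cq_def C_w_minus[OF wp])
  also have "I 5 = cp x"
    unfolding I(1) by (simp add: f_def cp_def)
  also have "I 6 = cq y"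
    unfolding I(1) by (simp add: f_def cq_def)
  finally show ?thesis by (simp add: z)
qed

text \<open>The linear term predicted by the delta method: the gradient of \<open>h\<close> applied
  to the Hajek projections of the four U-statistics.\<close>

definition grad_psi :: "'a \<times> 'b \<Rightarrow> real" where
  "grad_psi z = (\<Sum>i\<in>{1..4}. m_deg i * h_grad wp wq mu i * psi1 wp wq mu i z)"

lemma sum_1_4: "(\<Sum>i\<in>{1..4::nat}. f i) = f 1 + f 2 + f 3 + (f 4 :: real)"
  by (simp add: eval_nat_numeral atLeastAtMostSuc_conv)

text \<open>The influence function obtained from characteristic functions agrees with the
  delta-method projection: by \<open>lin_eq_cf\<close> it is a combination of values of
  \<open>kerint\<close>, and the measures independent of \<open>z\<close> make up the
  constant.\<close>

lemma infl_eq_grad_psi: "\<exists>c. \<forall>z. infl z = grad_psi z + c"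
proof -
  \<comment> \<open>The pairing of \<open>cf P\<close> with \<open>dep mu\<close>, by
    \<open>integral_dep\<close>.\<close>
  define E where "E P = kerint P mu - kerint P (indep_part mu)" for P
  have intd: "integrable W (\<lambda>t. cnj (dep mu t) * cf P t)" if "borel_prob P" for P
  proof -
    interpret P: borel_prob P by fact
    have "norm (dep mu t) * norm (cf P t) \<le> 2 * 1" for t
      by (intro mult_mono norm_dep_le mu.borel_prob_axioms P.norm_cf_le) auto
    then show ?thesis
      by (intro W.integrable_bounded[of _ 2]) (auto simp: norm_mult)
  qed
  note E = integral_dep[OF mu.borel_prob_axioms, folded E_def]
  have infl: "infl z = 2 * (E (return borel z) - E mu - E (return borel (fst z) \<Otimes>\<^sub>M muY)
      - E (muX \<Otimes>\<^sub>M return borel (snd z)) + 2 * E (indep_part mu))" for z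
  proof -
    have bp: "borel_prob (return borel z)" "borel_prob (return borel (fst z) \<Otimes>\<^sub>M muY)"
      "borel_prob (muX \<Otimes>\<^sub>M return borel (snd z))"
      by (intro borel_prob_return borel_prob_pair muX.borel_prob_axioms muY.borel_prob_axioms)+
    note bp = this mu.borel_prob_axioms muI.borel_prob_axioms
    let ?D = "\<lambda>P t. cnj (dep mu t) * cf P t"
    have eq: "cnj (dep mu t) * lin t z = ?D (return borel z) t - ?D mu t - ?D (return borel (fst z) \<Otimes>\<^sub>M muY) t
      - ?D (muX \<Otimes>\<^sub>M return borel (snd z)) t + 2 * ?D (indep_part mu) t" for t
      unfolding lin_eq_cf by (simp only: algebra_simps)
    have "integrable W (\<lambda>t. cnj (dep mu t) * lin t z)"
      unfolding eq by (intro Bochner_Integration.integrable_diff Bochner_Integration.integrable_add integrable_mult_right intd bp)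
    from integral_Re[OF this] have "infl z = 2 * Re (\<integral>t. cnj (dep mu t) * lin t z \<partial>W)"
      unfolding infl_def by (simp del: times_complex.sel)
    also have "(\<integral>t. cnj (dep mu t) * lin t z \<partial>W) = complex_of_real (E (return borel z)) - complex_of_real (E mu)
        - complex_of_real (E (return borel (fst z) \<Otimes>\<^sub>M muY))
        - complex_of_real (E (muX \<Otimes>\<^sub>M return borel (snd z))) + 2 * complex_of_real (E (indep_part mu))"
      unfolding eq by (simp add: intd bp E del: cf_return)
    finally show ?thesis by simp
  qed
  \<comment> \<open>The product of potentials, \<open>cp\<close> and \<open>cq\<close> all carry the
    coefficient -2, which is one third of \<open>m_deg 4\<close> times the fourth gradient
    entry.\<close>
  have "infl z = grad_psi z + (4 * E (indep_part mu) - 2 * E mu)" for z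
    using infl[of z] unfolding grad_psi_def sum_1_4
    by (simp add: E_def kerint_return kerint_return_muY kerint_muX_return m_deg_def h_grad_def psi1_4
        psi1_simps field_simps)
  then show ?thesis by blast
qed

lemma psi1_measurable: "psi1 wp wq mu i \<in> borel_measurable borel"
proof -
  have [measurable]: "cp \<in> borel_measurable borel" "cq \<in> borel_measurable borel"
    unfolding cp_def cq_def by measurable
  \<comment> \<open>Every index other than 1, 2, 3 falls into the default branch, hence agrees with
    index 4.\<close>
  have "psi1 wp wq mu i = (if i = 1 then psi1 wp wq mu 1 else if i = 2 then psi1 wp wq mu 2
      else if i = 3 then psi1 wp wq mu 3 else psi1 wp wq mu 4)"
    by (auto simp: psi1_def fun_eq_iff)
  also have "\<dots> \<in> borel_measurable borel"
    unfolding psi1_4 psi1_simps One_nat_def by (auto simp: psi1_4 psi1_simps cong: measurable_cong)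
  finally show ?thesis .
qed

lemma abs_psi1_le: "\<bar>psi1 wp wq mu i z\<bar> \<le> 1"
proof -
  have 4: "\<bar>psi4 wp wq z z1 z2\<bar> \<le> 1" for z1 z2
    using abs_CpCq_le[of "fst z - fst z1" "snd z - snd z2"] abs_CpCq_le[of "fst z - fst z2" "snd z - snd z1"]
     abs_CpCq_le[of "fst z - fst z1" "snd z1 - snd z2"] abs_CpCq_le[of "fst z1 - fst z2" "snd z - snd z1"]
     abs_CpCq_le[of "fst z - fst z2" "snd z1 - snd z2"] abs_CpCq_le[of "fst z1 - fst z2" "snd z - snd z2"]
    by (simp add: psi4_def)
  have "norm (\<integral>z1. C_w wp (fst z - fst z1) * C_w wq (snd z - snd z1) \<partial>mu) \<le> 1"
    "norm (\<integral>z1. C_w wp (fst z - fst z1) \<partial>mu) \<le> 1" "norm (\<integral>z1. C_w wq (snd z - snd z1) \<partial>mu) \<le> 1"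
    "norm (\<integral>z1. \<integral>z2. psi4 wp wq z z1 z2 \<partial>mu \<partial>mu) \<le> 1"
    by (intro mu.norm_integral_le; simp only: real_norm_def abs_CpCq_le abs_C_w_le wp wq 4)+
  then show ?thesis
    by (simp add: psi1_def)
qed

text \<open>The double sum of covariances is the variance of \<open>grad_psi\<close>. Adding a
  constant preserves the variance, and \<open>infl\<close> has mean zero, so only its second moment
  remains.\<close>

lemma sigma2_eq: "sigma2 wp wq mu = (\<integral>z. (infl z)\<^sup>2 \<partial>mu)"
proof -
  let ?c = "\<lambda>i. m_deg i * h_grad wp wq mu i"
  let ?p = "psi1 wp wq mu"
  note [measurable] = psi1_measurable
  have int1: "integrable mu (?p i)" for i
    by (rule mu.integrable_bounded[of _ 1]) (auto simp: abs_psi1_le)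
  have int2: "integrable mu (\<lambda>z. ?p i z * ?p j z)" for i j
    by (rule mu.integrable_bounded[of _ 1]) (auto simp: abs_mult abs_psi1_le intro!: mult_le_one)
  have sq: "(grad_psi z)\<^sup>2 = (\<Sum>i\<in>{1..4}. \<Sum>j\<in>{1..4}. ?c i * ?c j * (?p i z * ?p j z))" for z
    unfolding power2_eq_square grad_psi_def sum_product by (simp add: mult_ac)
  have e: "(\<integral>z. grad_psi z \<partial>mu) = (\<Sum>i\<in>{1..4}. ?c i * (\<integral>z. ?p i z \<partial>mu))"
    unfolding grad_psi_def by (simp add: int1)
  have "sigma2 wp wq mu = (\<integral>z. (grad_psi z)\<^sup>2 \<partial>mu) - (\<integral>z. grad_psi z \<partial>mu)\<^sup>2"
    unfolding sq e sigma2_def zeta1_def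
    by (simp add: int2 power2_eq_square sum_product right_diff_distrib sum_subtractf mult_ac)
  moreover obtain c where c: "\<And>z. infl z = grad_psi z + c"
    using infl_eq_grad_psi by blast
  have ig: "integrable mu grad_psi"
    unfolding grad_psi_def by (simp add: int1)
  have ig2: "integrable mu (\<lambda>z. (grad_psi z)\<^sup>2)"
    unfolding sq by (simp add: int2)
  have P1: "measure mu UNIV = 1" using mu.prob_space by simp
  have "(\<integral>z. grad_psi z \<partial>mu) + c = 0"
    using integral_infl_mu ig P1 unfolding c by simp
  moreover have "(\<integral>z. (infl z)\<^sup>2 \<partial>mu) = (\<integral>z. (grad_psi z)\<^sup>2 \<partial>mu) + 2 * c * (\<integral>z. grad_psi z \<partial>mu) + c\<^sup>2"
    unfolding c power2_sum using ig ig2 P1 by (simp add: mult_ac)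
  moreover have "c = - (\<integral>z. grad_psi z \<partial>mu)" using calculation by simp
  ultimately show ?thesis by (simp add: power2_eq_square)
qed

end

section \<open>Empirical measures and V-statistics\<close>

text \<open>The image of the uniform law on the indices, so repeated sample points keep their
  multiplicity. For \<open>n = 0\<close> the index law is an unspecified probability measure, so
  explicit formulas ask for \<open>n > 0\<close>.\<close>

definition empirical :: "(nat \<Rightarrow> 'c::euclidean_space) \<Rightarrow> nat \<Rightarrow> 'c measure" where
  "empirical z n = distr (measure_pmf (pmf_of_set {..<n})) borel z"

lemma borel_prob_empirical: "borel_prob (empirical z n)"
  unfolding empirical_def by (rule borel_prob_distr) (auto simp: measure_pmf.prob_space_axioms)

lemma integral_empirical:
  fixes f :: "'c::euclidean_space \<Rightarrow> 'd::{banach, second_countable_topology}"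
  assumes "f \<in> borel_measurable borel" "n > 0"
  shows "(\<integral>x. f x \<partial>(empirical z n)) = (\<Sum>i<n. f (z i)) /\<^sub>R real n"
proof -
  have ne: "{..<n} \<noteq> {}" using assms(2) by auto
  have "(\<integral>x. f x \<partial>(empirical z n)) = (\<integral>i. f (z i) \<partial>(measure_pmf (pmf_of_set {..<n})))"
    unfolding empirical_def by (rule integral_distr) (use assms in auto)
  also have "\<dots> = (\<Sum>i<n. pmf (pmf_of_set {..<n}) i *\<^sub>R f (z i))"
    by (rule integral_measure_pmf) (use ne in auto)
  also have "\<dots> = (\<Sum>i<n. f (z i)) /\<^sub>R real n"
    using ne by (simp add: scaleR_sum_right inverse_eq_divide)
  finally show ?thesis .
qed

lemma distr_empirical:
  assumes "f \<in> borel_measurable borel"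
  shows "distr (empirical z n) borel f = empirical (\<lambda>i. f (z i)) n"
  unfolding empirical_def using assms by (subst distr_distr) (auto simp: comp_def)

lemma cf_empirical: "n > 0 \<Longrightarrow> cf (empirical z n) t = (\<Sum>i<n. cis (t \<bullet> z i)) / of_nat n"
  unfolding cf_def by (subst integral_empirical) (auto simp: scaleR_conv_of_real field_simps)

text \<open>The missing fraction \<open>1 - card A / card B\<close> is paid twice: once for the
  changed normalization and once for the omitted terms.\<close>

lemma mean_subset_diff_le:
  fixes f :: "'i \<Rightarrow> real"
  assumes "finite B" "A \<subseteq> B" "A \<noteq> {}" "\<And>i. i \<in> B \<Longrightarrow> \<bar>f i\<bar> \<le> 1"
  shows "\<bar>sum f A / card A - sum f B / card B\<bar> \<le> 2 * (1 - card A / card B)"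
proof -
  have fA: "finite A" using assms finite_subset by blast
  have cA: "real (card A) > 0" using fA assms(3) by (simp add: card_gt_0_iff)
  have cAB: "real (card A) \<le> real (card B)" using assms(1,2) by (simp add: card_mono)
  have abs_sum: "\<bar>sum f C\<bar> \<le> card C" if "C \<subseteq> B" for C
  proof -
    have "\<bar>sum f C\<bar> \<le> (\<Sum>i\<in>C. \<bar>f i\<bar>)" by (rule sum_abs)
    also have "\<dots> \<le> (\<Sum>i\<in>C. 1)" using assms(4) that by (intro sum_mono) auto
    finally show ?thesis by simp
  qed
  have split: "sum f B = sum f A + sum f (B - A)"
    using sum.subset_diff[OF assms(2,1), of f] by simp
  have "sum f A / card A - sum f B / card B
      = sum f A * (1 / card A - 1 / card B) - sum f (B - A) / card B"
    unfolding split by (simp add: field_simps add_divide_distrib)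
  also have "\<bar>\<dots>\<bar> \<le> \<bar>sum f A\<bar> * (1 / card A - 1 / card B) + \<bar>sum f (B - A)\<bar> / card B"
  proof -
    have "1 / real (card B) \<le> 1 / real (card A)"
      using cA cAB by (simp add: frac_le)
    then show ?thesis
      using abs_triangle_ineq4[of "sum f A * (1 / card A - 1 / card B)" "sum f (B - A) / card B"]
      by (simp add: abs_mult)
  qed
  also have "\<dots> \<le> card A * (1 / card A - 1 / card B) + card (B - A) / card B"
    using abs_sum[OF assms(2)] abs_sum[of "B - A"] cA cAB
    by (intro add_mono mult_right_mono divide_right_mono) (auto simp: frac_le)
  also have "\<dots> = 2 * (1 - card A / card B)"
  proof -
    have eq: "real (card (B - A)) = real (card B) - real (card A)"
      using assms(1,2) fA by (simp add: card_Diff_subset of_nat_diff card_mono)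
    have "real (card B) > 0" using cA cAB by linarith
    then show ?thesis unfolding eq using cA by (simp add: field_simps del: of_nat_0_less_iff)
  qed
  finally show ?thesis .
qed

lemma sum_distinct_pairs:
  "(\<Sum>i<n. \<Sum>j<n. if i \<noteq> j then 1 else 0) = real n * (real n - 1)"
proof -
  have "(\<Sum>j<n. if i \<noteq> j then 1 else 0) = real n - 1" if "i < n" for i
    using that by (subst sum.remove[of _ i]) (auto simp: of_nat_diff)
  then show ?thesis by simp
qed

lemma distinct_pairs_mean_diff:
  fixes f :: "nat \<Rightarrow> nat \<Rightarrow> real"
  assumes n: "n \<ge> 2" and f: "\<And>i j. \<bar>f i j\<bar> \<le> 1"
  shows "\<bar>(\<Sum>i<n. \<Sum>j<n. if i \<noteq> j then f i j else 0) / (real n * (real n - 1))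
      - (\<Sum>i<n. \<Sum>j<n. f i j) / (real n)\<^sup>2\<bar> \<le> 2 / n"
proof -
  let ?B = "{..<n} \<times> {..<n}"
  let ?A = "{p \<in> ?B. fst p \<noteq> snd p}"
  have sum_A: "(\<Sum>i<n. \<Sum>j<n. if i \<noteq> j then g i j else 0) = (\<Sum>p\<in>?A. g (fst p) (snd p))"
    for g :: "nat \<Rightarrow> nat \<Rightarrow> real"
    by (subst sum.inter_filter) (auto simp: sum.cartesian_product case_prod_unfold)
  have card_A: "real (card ?A) = real n * (real n - 1)"
    unfolding sum_distinct_pairs[symmetric] sum_A by simp
  have "(0, 1) \<in> ?A" using n by auto
  then have "?A \<noteq> {}" by blast
  then have "\<bar>(\<Sum>p\<in>?A. f (fst p) (snd p)) / card ?A - (\<Sum>p\<in>?B. f (fst p) (snd p)) / card ?B\<bar>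
      \<le> 2 * (1 - card ?A / card ?B)"
    using f by (intro mean_subset_diff_le) auto
  \<comment> \<open>The diagonal is the fraction \<open>1 / n\<close> of all pairs.\<close>
  also have "2 * (1 - card ?A / card ?B) = 2 / n"
    using n unfolding card_A by (simp add: field_simps)
  finally show ?thesis
    unfolding sum_A card_A by (simp add: sum.cartesian_product case_prod_unfold power2_eq_square)
qed

lemma distinct_triples_mean_diff:
  fixes f :: "nat \<Rightarrow> nat \<Rightarrow> nat \<Rightarrow> real"
  assumes n: "n \<ge> 3" and f: "\<And>i j k. \<bar>f i j k\<bar> \<le> 1"
  shows "\<bar>(\<Sum>i<n. \<Sum>j<n. \<Sum>k<n. if i \<noteq> j \<and> i \<noteq> k \<and> j \<noteq> k then f i j k else 0)
        / (real n * (real n - 1) * (real n - 2))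
      - (\<Sum>i<n. \<Sum>j<n. \<Sum>k<n. f i j k) / (real n) ^ 3\<bar> \<le> 6 / n"
proof -
  let ?B = "{..<n} \<times> {..<n} \<times> {..<n}"
  let ?P = "\<lambda>i j k. i \<noteq> j \<and> i \<noteq> k \<and> j \<noteq> k"
  let ?A = "{p \<in> ?B. ?P (fst p) (fst (snd p)) (snd (snd p))}"
  have sum_B: "(\<Sum>i<n. \<Sum>j<n. \<Sum>k<n. g i j k) = (\<Sum>p\<in>?B. g (fst p) (fst (snd p)) (snd (snd p)))"
    for g :: "nat \<Rightarrow> nat \<Rightarrow> nat \<Rightarrow> real"
    by (simp add: sum.cartesian_product case_prod_unfold)
  have sum_A: "(\<Sum>i<n. \<Sum>j<n. \<Sum>k<n. if ?P i j k then g i j k else 0)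
      = (\<Sum>p\<in>?A. g (fst p) (fst (snd p)) (snd (snd p)))"
    for g :: "nat \<Rightarrow> nat \<Rightarrow> nat \<Rightarrow> real"
    unfolding sum_B by (subst sum.inter_filter) auto
  have k: "(\<Sum>k<n. if ?P i j k then 1 else (0::real)) = (if i \<noteq> j then real n - 2 else 0)"
    if "i < n" "j < n" for i j
  proof (cases "i = j")
    case False
    have "(\<Sum>k<n. if ?P i j k then 1 else (0::real)) = (\<Sum>k\<in>{..<n} - {i, j}. 1)"
      by (rule sum.mono_neutral_cong_right) (use False in auto)
    also have "\<dots> = real n - 2"
      using that False n by (simp add: card_Diff_subset of_nat_diff)
    finally show ?thesis using False by simp
  qed simp
  have j: "(\<Sum>j<n. \<Sum>k<n. if ?P i j k then 1 else (0::real)) = (real n - 1) * (real n - 2)" if "i < n" for i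
  proof -
    have "(\<Sum>j<n. \<Sum>k<n. if ?P i j k then 1 else (0::real)) = (\<Sum>j<n. if i \<noteq> j then real n - 2 else 0)"
      by (rule sum.cong) (use k[OF that] in auto)
    also have "\<dots> = (\<Sum>j\<in>{..<n} - {i}. real n - 2)"
      by (rule sum.mono_neutral_cong_right) auto
    also have "\<dots> = (real n - 1) * (real n - 2)"
      using that n by (simp add: of_nat_diff)
    finally show ?thesis .
  qed
  have "(\<Sum>i<n. \<Sum>j<n. \<Sum>k<n. if ?P i j k then 1 else (0::real)) = (\<Sum>i<n. (real n - 1) * (real n - 2))"
    by (rule sum.cong) (use j in auto)
  then have card_A: "real (card ?A) = real n * (real n - 1) * (real n - 2)"
    unfolding sum_A by simp
  have card_B: "real (card ?B) = real n ^ 3"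
    by (simp add: card_cartesian_product power3_eq_cube)
  have "(0, 1, 2) \<in> ?A" using n by auto
  then have "?A \<noteq> {}" by blast
  then have "\<bar>(\<Sum>p\<in>?A. f (fst p) (fst (snd p)) (snd (snd p))) / card ?A
      - (\<Sum>p\<in>?B. f (fst p) (fst (snd p)) (snd (snd p))) / card ?B\<bar> \<le> 2 * (1 - card ?A / card ?B)"
    using f by (intro mean_subset_diff_le) auto
  \<comment> \<open>The fraction of triples with a repeated index is
    \<open>(3 * n - 2) / n^2\<close>, which is at most \<open>3 / n\<close>.\<close>
  also have "2 * (1 - card ?A / card ?B) \<le> 6 / n"
    using n unfolding card_A card_B
    by (simp add: divide_simps power3_eq_cube) (simp add: algebra_simps)
  finally show ?thesis
    unfolding sum_A card_A unfolding sum_B card_B .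
qed

section \<open>Comparison of the U-statistic with the empirical distance\<close>

context indep_weights
begin

text \<open>By \<open>indep_dist_eq_S\<close> the empirical distance is the V-statistic counterpart
  of \<open>Delta_n\<close>, so the four normalized sums are compared one by one.\<close>

lemma Delta_n_empirical:
  assumes n: "n \<ge> 3"
  shows "\<bar>Delta_n wp wq z n - indep_dist wp wq (empirical z n)\<bar> \<le> 18 / n"
proof -
  let ?P = "\<lambda>i j. C_w wp (fst (z i) - fst (z j))" and ?Q = "\<lambda>i j. C_w wq (snd (z i) - snd (z j))"
  let ?N = "empirical z n"
  interpret N: borel_prob ?N by (rule borel_prob_empirical)
  have n0: "n > 0" using n by simp
  have S1: "S1 wp wq ?N = (\<Sum>i<n. \<Sum>j<n. ?P i j * ?Q i j) / (real n)\<^sup>2"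
    unfolding S1_def using n0
    by (simp add: integral_empirical sum_divide_distrib power2_eq_square divide_simps flip: sum_distrib_left)
  have S2: "S2 wp ?N = (\<Sum>i<n. \<Sum>j<n. ?P i j) / (real n)\<^sup>2"
    unfolding S2_def using n0
    by (simp add: integral_empirical sum_divide_distrib power2_eq_square divide_simps flip: sum_distrib_left)
  have S3: "S3 wq ?N = (\<Sum>i<n. \<Sum>j<n. ?Q i j) / (real n)\<^sup>2"
    unfolding S3_def using n0
    by (simp add: integral_empirical sum_divide_distrib power2_eq_square divide_simps flip: sum_distrib_left)
  have S4: "S4 wp wq ?N = (\<Sum>i<n. \<Sum>j<n. \<Sum>k<n. ?P i j * ?Q i k) / (real n) ^ 3"
  proof -
    define p where "p i = (\<Sum>j<n. ?P i j)" for i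
    define q where "q i = (\<Sum>k<n. ?Q i k)" for i
    have "S4 wp wq ?N = (\<Sum>i<n. (p i / n) * (q i / n)) / n"
      unfolding S4_def p_def q_def using n0 by (simp add: integral_empirical divide_inverse mult_ac flip: sum_distrib_left)
    also have "\<dots> = (\<Sum>i<n. p i * q i) / (real n) ^ 3"
      by (simp add: sum_divide_distrib power3_eq_cube mult_ac)
    also have "(\<Sum>i<n. p i * q i) = (\<Sum>i<n. \<Sum>j<n. \<Sum>k<n. ?P i j * ?Q i k)"
      by (simp add: p_def q_def sum_product)
    finally show ?thesis .
  qed
  have 1: "\<bar>U1 wp wq z n - S1 wp wq ?N\<bar> \<le> 2 / n"
    unfolding U1_def S1 by (rule distinct_pairs_mean_diff) (use n abs_CpCq_le in auto)
  have 2: "\<bar>U2 wp z n - S2 wp ?N\<bar> \<le> 2 / n"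
    unfolding U2_def S2 by (rule distinct_pairs_mean_diff) (use n abs_C_w_le wp in auto)
  have 3: "\<bar>U3 wq z n - S3 wq ?N\<bar> \<le> 2 / n"
    unfolding U3_def S3 by (rule distinct_pairs_mean_diff) (use n abs_C_w_le wq in auto)
  have 4: "\<bar>U4 wp wq z n - S4 wp wq ?N\<bar> \<le> 6 / n"
    unfolding U4_def S4 by (rule distinct_triples_mean_diff) (use n abs_CpCq_le in auto)
  have S2_le: "\<bar>S2 wp ?N\<bar> \<le> 1"
    unfolding S2_def real_norm_def[symmetric]
    by (intro N.norm_integral_le; simp only: real_norm_def abs_C_w_le wp)
  have U3_le: "\<bar>U3 wq z n\<bar> \<le> 1"
  proof -
    have "\<bar>\<Sum>i<n. \<Sum>j<n. if i \<noteq> j then ?Q i j else 0\<bar> \<le> (\<Sum>i<n. \<Sum>j<n. if i \<noteq> j then 1 else 0)"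
      using abs_C_w_le[OF wq] by (intro order.trans[OF sum_abs] sum_mono) auto
    also have "\<dots> = real n * (real n - 1)"
      by (rule sum_distinct_pairs)
    finally show ?thesis
      unfolding U3_def using n by (simp add: abs_mult divide_le_eq)
  qed
  \<comment> \<open>Telescoping the product calls for a bound on one factor of each kind:
    \<open>U3\<close> and the empirical \<open>S2\<close>.\<close>
  have "U2 wp z n * U3 wq z n - S2 wp ?N * S3 wq ?N
      = (U2 wp z n - S2 wp ?N) * U3 wq z n + S2 wp ?N * (U3 wq z n - S3 wq ?N)"
    by (simp add: algebra_simps)
  also have "\<bar>\<dots>\<bar> \<le> \<bar>U2 wp z n - S2 wp ?N\<bar> * \<bar>U3 wq z n\<bar> + \<bar>S2 wp ?N\<bar> * \<bar>U3 wq z n - S3 wq ?N\<bar>"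
    by (metis abs_mult abs_triangle_ineq)
  also have "\<dots> \<le> 2 / n * 1 + 1 * (2 / n)"
    by (intro add_mono mult_mono 2 3 S2_le U3_le) auto
  finally have 23: "\<bar>U2 wp z n * U3 wq z n - S2 wp ?N * S3 wq ?N\<bar> \<le> 2 / n + 2 / n" by simp
  \<comment> \<open>The errors of \<open>U1\<close>, of the product and of twice \<open>U4\<close>
    add up to 18.\<close>
  have "\<bar>Delta_n wp wq z n - indep_dist wp wq ?N\<bar> \<le> 2 / n + (2 / n + 2 / n) + 2 * (6 / n)"
    unfolding Delta_n_def indep_dist_eq_S[OF N.borel_prob_axioms]
    using 1 23 4 by linarith
  then show ?thesis by simp
qed

end

section \<open>Probabilistic tools\<close>

lemma cmod_iexp_diff_le: "cmod (iexp x - iexp y) \<le> \<bar>x - y\<bar>"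
proof -
  have "iexp x - iexp y = iexp y * (iexp (x - y) - 1)"
    by (simp add: algebra_simps flip: exp_add)
  then have "cmod (iexp x - iexp y) = cmod (iexp (x - y) - 1)"
    by (simp add: norm_mult)
  also have "\<dots> \<le> \<bar>x - y\<bar>"
    using iexp_approx1[of "x - y" 0] by simp
  finally show ?thesis .
qed

section \<open>Centered normal laws, the degenerate one included\<close>

lemma real_distribution_normal_law: "0 \<le> v \<Longrightarrow> real_distribution (normal_law v)"
proof -
  assume "0 \<le> v"
  then have "prob_space (normal_law v)"
    unfolding normal_law_def by (auto intro!: prob_space_return prob_space_normal_density)
  then show ?thesis
    by (simp add: real_distribution_def real_distribution_axioms_def normal_law_def)
qed

text \<open>The formula covers the point mass at variance 0 as well; in the other case the law is a
  scaled standard normal.\<close>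

lemma char_normal_law:
  assumes "0 \<le> v"
  shows "char (normal_law v) t = complex_of_real (exp (- (v * t\<^sup>2) / 2))"
proof (cases "v = 0")
  case True
  then show ?thesis by (simp add: normal_law_def char_def integral_return)
next
  case False
  with assms have v: "sqrt v > 0" by simp
  interpret std: prob_space std_normal_distribution
    by (rule prob_space_normal_density) simp
  have "distributed std_normal_distribution lborel (\<lambda>x. x) std_normal_density"
    unfolding distributed_def by (auto simp: distr_id2)
  then have "distributed std_normal_distribution lborel (\<lambda>x. 0 + sqrt v * x)
      (normal_density (0 + sqrt v * 0) (\<bar>sqrt v\<bar> * 1))"
    by (intro std.normal_density_affine) (use v in auto)
  then have "distr std_normal_distribution lborel (\<lambda>x. sqrt v * x) = normal_law v"
    using v False by (simp add: distributed_def normal_law_def)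
  \<comment> \<open>The target \<open>lborel\<close> may be replaced by \<open>borel\<close>, since
    only its measurable sets matter to an image measure.\<close>
  moreover have "distr std_normal_distribution lborel (\<lambda>x. sqrt v * x)
      = distr std_normal_distribution borel (\<lambda>x. sqrt v * x)"
    by (rule distr_cong) auto
  ultimately have eq: "normal_law v = distr std_normal_distribution borel (\<lambda>x. sqrt v * x)" by simp
  have "char (normal_law v) t = char std_normal_distribution (sqrt v * t)"
    unfolding eq char_def by (subst integral_distr) (auto simp: mult_ac)
  also have "\<dots> = complex_of_real (exp (- (v * t\<^sup>2) / 2))"
    using assms by (simp add: char_std_normal_distribution power_mult_distrib)
  finally show ?thesis .
qed

section \<open>Perturbation of weak limits and mean-square bounds for empirical means\<close>

context prob_space
begin

lemma char_distr:
  assumes [measurable]: "random_variable borel V"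
  shows "char (distr M borel V) t = (CLINT \<omega>|M. iexp (t * V \<omega>))"
  unfolding char_def by (subst integral_distr) auto

text \<open>An L1 form of Slutsky's lemma: \<open>iexp\<close> is 1-Lipschitz, so the two
  characteristic functions approach each other and Levy's continuity theorem applies. Integrability
  is asked only eventually, because the remainder estimates start at \<open>n = 3\<close>.\<close>

lemma weak_conv_L1_perturbation:
  fixes X Y :: "nat \<Rightarrow> 'a \<Rightarrow> real"
  assumes X: "\<And>n. random_variable borel (X n)" and Y: "\<And>n. random_variable borel (Y n)"
    and int: "\<forall>\<^sub>F n in sequentially. integrable M (\<lambda>\<omega>. X n \<omega> - Y n \<omega>)"
    and lim: "(\<lambda>n. expectation (\<lambda>\<omega>. \<bar>X n \<omega> - Y n \<omega>\<bar>)) \<longlonglongrightarrow> 0"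
    and N: "real_distribution N"
    and char: "\<And>t. (\<lambda>n. char (distr M borel (Y n)) t) \<longlonglongrightarrow> char N t"
  shows "weak_conv_m (\<lambda>n. distr M borel (X n)) N"
proof (rule levy_continuity)
  show "real_distribution (distr M borel (X n))" for n
    using X by simp
  show "real_distribution N" by fact
  fix t :: real
  note [measurable] = X Y
  have intexp: "integrable M (\<lambda>\<omega>. iexp (t * V \<omega>))"
    if [measurable]: "random_variable borel V" for V
    by (rule integrable_const_bound[of _ 1]) auto
  have "\<forall>\<^sub>F n in sequentially. norm (char (distr M borel (X n)) t - char (distr M borel (Y n)) t)
      \<le> \<bar>t\<bar> * expectation (\<lambda>\<omega>. \<bar>X n \<omega> - Y n \<omega>\<bar>)"
    using int
  proof eventually_elim
    case (elim n)
    have "char (distr M borel (X n)) t - char (distr M borel (Y n)) t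
        = (CLINT \<omega>|M. iexp (t * X n \<omega>) - iexp (t * Y n \<omega>))"
      unfolding char_distr[OF X] char_distr[OF Y] by (rule Bochner_Integration.integral_diff[symmetric]) (intro intexp X Y)+
    also have "norm \<dots> \<le> expectation (\<lambda>\<omega>. norm (iexp (t * X n \<omega>) - iexp (t * Y n \<omega>)))"
      by (rule integral_norm_bound)
    also have "\<dots> \<le> expectation (\<lambda>\<omega>. \<bar>t\<bar> * \<bar>X n \<omega> - Y n \<omega>\<bar>)"
    proof (rule integral_mono)
      show "integrable M (\<lambda>\<omega>. norm (iexp (t * X n \<omega>) - iexp (t * Y n \<omega>)))"
        by (intro integrable_norm Bochner_Integration.integrable_diff intexp X Y)
      show "integrable M (\<lambda>\<omega>. \<bar>t\<bar> * \<bar>X n \<omega> - Y n \<omega>\<bar>)"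
        using elim by simp
      show "norm (iexp (t * X n \<omega>) - iexp (t * Y n \<omega>)) \<le> \<bar>t\<bar> * \<bar>X n \<omega> - Y n \<omega>\<bar>" for \<omega>
        using cmod_iexp_diff_le[of "t * X n \<omega>" "t * Y n \<omega>"]
        by (simp add: abs_mult flip: right_diff_distrib)
    qed
    finally show ?case by simp
  qed
  moreover have "(\<lambda>n. \<bar>t\<bar> * expectation (\<lambda>\<omega>. \<bar>X n \<omega> - Y n \<omega>\<bar>)) \<longlonglongrightarrow> 0"
    using tendsto_mult_left[OF lim, of "\<bar>t\<bar>"] by simp
  ultimately have "(\<lambda>n. char (distr M borel (X n)) t - char (distr M borel (Y n)) t) \<longlonglongrightarrow> 0"
    by (rule Lim_null_comparison)
  from tendsto_add[OF this char[of t]] show "(\<lambda>n. char (distr M borel (X n)) t) \<longlonglongrightarrow> char N t"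
    by simp
qed

text \<open>After centering, independence removes the mixed products, so only \<open>n\<close> of
  the \<open>n^2\<close> expectations survive, each at most 1.\<close>

lemma mean_square_deviation_le:
  fixes Z :: "nat \<Rightarrow> 'a \<Rightarrow> 'c::euclidean_space" and f :: "'c \<Rightarrow> real"
  assumes ind: "indep_vars (\<lambda>_. borel) Z UNIV" and dist: "\<And>i. distr M borel (Z i) = mu"
    and f [measurable]: "f \<in> borel_measurable borel" and bd: "\<And>z. \<bar>f z\<bar> \<le> 1" and n: "n > 0"
  shows "expectation (\<lambda>\<omega>. ((\<Sum>i<n. f (Z i \<omega>)) / n - (\<integral>z. f z \<partial>mu))\<^sup>2) \<le> 1 / n"
proof -
  have Z [measurable]: "random_variable borel (Z i)" for i
    using ind unfolding indep_vars_def2 by simp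
  define m where "m = (\<integral>z. f z \<partial>mu)"
  define Y where "Y i \<omega> = f (Z i \<omega>) - m" for i \<omega>
  have [measurable]: "random_variable borel (Y i)" for i
    unfolding Y_def by measurable
  have int_f: "integrable M (\<lambda>\<omega>. f (Z i \<omega>))" for i
    by (rule integrable_const_bound[of _ 1]) (auto simp: bd)
  have int_f2: "integrable M (\<lambda>\<omega>. (f (Z i \<omega>))\<^sup>2)" for i
    by (rule integrable_const_bound[of _ 1]) (auto simp: bd abs_square_le_1)
  have Ef: "expectation (\<lambda>\<omega>. f (Z i \<omega>)) = m" for i
    unfolding m_def dist[of i, symmetric] by (rule integral_distr[symmetric]) auto
  have EY: "expectation (Y i) = 0" for i
    unfolding Y_def using int_f Ef by (simp add: prob_space)
  have "\<bar>m\<bar> \<le> 1"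
  proof -
    have "\<bar>m\<bar> \<le> expectation (\<lambda>\<omega>. \<bar>f (Z 0 \<omega>)\<bar>)"
      unfolding Ef[of 0, symmetric] by (rule integral_abs_bound)
    also have "\<dots> \<le> expectation (\<lambda>\<omega>. 1)"
      using int_f by (intro integral_mono) (auto simp: bd)
    finally show ?thesis by (simp add: prob_space)
  qed
  then have Y_le: "\<bar>Y i \<omega>\<bar> \<le> 2" for i \<omega>
    using bd[of "Z i \<omega>"] unfolding Y_def by linarith
  have int_YY: "integrable M (\<lambda>\<omega>. Y i \<omega> * Y j \<omega>)" for i j
  proof (rule integrable_const_bound[of _ "2 * 2"])
    have "\<bar>Y i \<omega>\<bar> * \<bar>Y j \<omega>\<bar> \<le> 2 * 2" for \<omega> by (intro mult_mono Y_le) auto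
    then show "AE \<omega> in M. norm (Y i \<omega> * Y j \<omega>) \<le> 2 * 2" by (simp add: abs_mult)
  qed auto
  have int_Y: "integrable M (Y i)" for i
    by (rule integrable_const_bound[of _ 2]) (auto simp: Y_le)
  have EYY: "expectation (\<lambda>\<omega>. Y i \<omega> * Y j \<omega>) = 0" if "i \<noteq> j" for i j
  proof -
    have "indep_vars (\<lambda>_. borel) Y UNIV"
      unfolding Y_def by (rule indep_vars_compose2[OF ind]) auto
    then have "indep_vars (\<lambda>_. borel) Y {i, j}"
      by (rule indep_vars_subset) simp
    then have "expectation (\<lambda>\<omega>. \<Prod>k\<in>{i, j}. Y k \<omega>) = (\<Prod>k\<in>{i, j}. expectation (Y k))"
      by (intro indep_vars_lebesgue_integral) (auto simp: int_Y)
    then show ?thesis using that EY by simp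
  qed
  have EY2: "expectation (\<lambda>\<omega>. Y i \<omega> * Y i \<omega>) \<le> 1" for i
  proof -
    have "expectation (\<lambda>\<omega>. Y i \<omega> * Y i \<omega>) = expectation (\<lambda>\<omega>. (f (Z i \<omega>))\<^sup>2) - m\<^sup>2"
      using variance_eq[OF int_f int_f2, of i] by (simp add: Y_def Ef power2_eq_square)
    also have "\<dots> \<le> expectation (\<lambda>\<omega>. (f (Z i \<omega>))\<^sup>2)" by simp
    also have "\<dots> \<le> expectation (\<lambda>\<omega>. 1)"
      using int_f2 by (intro integral_mono) (auto simp: bd abs_square_le_1)
    finally show ?thesis by (simp add: prob_space)
  qed
  have "(\<Sum>i<n. f (Z i \<omega>)) / n - m = (\<Sum>i<n. Y i \<omega>) / n" for \<omega>
    using n by (simp add: Y_def sum_subtractf field_simps)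
  then have "((\<Sum>i<n. f (Z i \<omega>)) / n - m)\<^sup>2 = (\<Sum>i<n. \<Sum>j<n. Y i \<omega> * Y j \<omega>) / n\<^sup>2" for \<omega>
    by (simp add: power_divide sum_product power2_eq_square)
  then have "expectation (\<lambda>\<omega>. ((\<Sum>i<n. f (Z i \<omega>)) / n - m)\<^sup>2)
      = (\<Sum>i<n. \<Sum>j<n. expectation (\<lambda>\<omega>. Y i \<omega> * Y j \<omega>)) / n\<^sup>2"
    by (simp add: int_YY)
  also have "(\<Sum>i<n. \<Sum>j<n. expectation (\<lambda>\<omega>. Y i \<omega> * Y j \<omega>)) = (\<Sum>i<n. expectation (\<lambda>\<omega>. Y i \<omega> * Y i \<omega>))"
  proof (rule sum.cong)
    fix i assume "i \<in> {..<n}"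
    then show "(\<Sum>j<n. expectation (\<lambda>\<omega>. Y i \<omega> * Y j \<omega>)) = expectation (\<lambda>\<omega>. Y i \<omega> * Y i \<omega>)"
      using EYY by (subst sum.remove[of _ i]) auto
  qed simp
  also have "(\<Sum>i<n. expectation (\<lambda>\<omega>. Y i \<omega> * Y i \<omega>)) / n\<^sup>2 \<le> (\<Sum>i<n. 1) / n\<^sup>2"
    by (intro divide_right_mono sum_mono EY2) auto
  also have "\<dots> = 1 / n"
    by (simp add: power2_eq_square)
  finally show ?thesis unfolding m_def .
qed

text \<open>The real and the imaginary part, a cosine and a sine mean, contribute
  \<open>1 / n\<close> each.\<close>

lemma mean_square_deviation_cis_le:
  fixes Z :: "nat \<Rightarrow> 'a \<Rightarrow> 'c::euclidean_space"
  assumes ind: "indep_vars (\<lambda>_. borel) Z UNIV" and dist: "\<And>i. distr M borel (Z i) = mu"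
    and n: "n > 0"
  shows "expectation (\<lambda>\<omega>. (cmod (cf (empirical (\<lambda>i. Z i \<omega>) n) t - cf mu t))\<^sup>2) \<le> 2 / n"
proof -
  have Z [measurable]: "random_variable borel (Z i)" for i
    using ind unfolding indep_vars_def2 by simp
  interpret mu: borel_prob mu
    unfolding dist[of 0, symmetric] by (rule borel_prob_distr) (auto simp: prob_space_axioms)
  have dev: "(cmod (cf (empirical (\<lambda>i. Z i \<omega>) n) t - cf mu t))\<^sup>2 =
      ((\<Sum>i<n. cos (t \<bullet> Z i \<omega>)) / n - (\<integral>z. cos (t \<bullet> z) \<partial>mu))\<^sup>2
      + ((\<Sum>i<n. sin (t \<bullet> Z i \<omega>)) / n - (\<integral>z. sin (t \<bullet> z) \<partial>mu))\<^sup>2" for \<omega>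
  proof -
    have "integrable mu (\<lambda>z. cis (t \<bullet> z))" by (rule mu.integrable_bounded[of _ 1]) auto
    from integral_Re[OF this] integral_Im[OF this]
    have "Re (cf mu t) = (\<integral>z. cos (t \<bullet> z) \<partial>mu)" "Im (cf mu t) = (\<integral>z. sin (t \<bullet> z) \<partial>mu)"
      by (simp_all add: cf_def)
    then show ?thesis
      by (simp add: cmod_power2 cf_empirical[OF n])
  qed
  have int: "integrable M (\<lambda>\<omega>. ((\<Sum>i<n. g (Z i \<omega>)) / n - m)\<^sup>2)"
    if [measurable]: "g \<in> borel_measurable borel" and "\<And>z. \<bar>g z\<bar> \<le> 1" for g :: "'c \<Rightarrow> real" and m
  proof (rule integrable_const_bound[of _ "(1 + \<bar>m\<bar>)\<^sup>2"])
    have "\<bar>\<Sum>i<n. g (Z i \<omega>)\<bar> \<le> n" for \<omega>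
      using order.trans[OF sum_abs[of "\<lambda>i. g (Z i \<omega>)" "{..<n}"]
          sum_mono[of "{..<n}" "\<lambda>i. \<bar>g (Z i \<omega>)\<bar>" "\<lambda>_. 1"]] that(2) by simp
    then have le1: "\<bar>(\<Sum>i<n. g (Z i \<omega>)) / n\<bar> \<le> 1" for \<omega>
      using n by (simp add: abs_divide divide_le_eq)
    have "\<bar>(\<Sum>i<n. g (Z i \<omega>)) / n - m\<bar> \<le> 1 + \<bar>m\<bar>" for \<omega>
      using abs_triangle_ineq4[of "(\<Sum>i<n. g (Z i \<omega>)) / n" m] le1[of \<omega>] by linarith
    then have "((\<Sum>i<n. g (Z i \<omega>)) / n - m)\<^sup>2 \<le> (1 + \<bar>m\<bar>)\<^sup>2" for \<omega>
      by (metis abs_ge_zero power2_abs power_mono)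
    then show "AE \<omega> in M. norm (((\<Sum>i<n. g (Z i \<omega>)) / n - m)\<^sup>2) \<le> (1 + \<bar>m\<bar>)\<^sup>2"
      by simp
  qed measurable
  have "expectation (\<lambda>\<omega>. (cmod (cf (empirical (\<lambda>i. Z i \<omega>) n) t - cf mu t))\<^sup>2) \<le> 1 / n + 1 / n"
    unfolding dev
    using mean_square_deviation_le[OF ind dist _ _ n, of "\<lambda>z. cos (t \<bullet> z)"]
      mean_square_deviation_le[OF ind dist _ _ n, of "\<lambda>z. sin (t \<bullet> z)"]
    by (subst Bochner_Integration.integral_add) (auto intro!: int)
  then show ?thesis by simp
qed

end

section \<open>The limit theorem\<close>

locale indep_sample = indep_setup wp wq mu + M: prob_space M
  for wp :: "'a::euclidean_space \<Rightarrow> real" and wq :: "'b::euclidean_space \<Rightarrow> real"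
    and mu :: "('a \<times> 'b) measure" and M :: "'m measure" +
  fixes Z :: "nat \<Rightarrow> 'm \<Rightarrow> 'a \<times> 'b"
  assumes indep_Z: "M.indep_vars (\<lambda>_. borel) Z UNIV"
    and distr_Z: "\<And>i. distr M borel (Z i) = mu"
begin

lemma Z_measurable [measurable]: "Z i \<in> borel_measurable M"
  using indep_Z unfolding M.indep_vars_def2 by simp

lemma distr_compose_Z:
  "f \<in> borel_measurable borel \<Longrightarrow> distr M borel (\<lambda>\<omega>. f (Z i \<omega>)) = distr mu borel f"
  unfolding distr_Z[of i, symmetric] by (subst distr_distr) (auto simp: comp_def)

lemma expectation_compose_Z:
  fixes f :: "'a \<times> 'b \<Rightarrow> real"
  shows "f \<in> borel_measurable borel \<Longrightarrow> M.expectation (\<lambda>\<omega>. f (Z i \<omega>)) = (\<integral>z. f z \<partial>mu)"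
  unfolding distr_Z[of i, symmetric] by (rule integral_distr[symmetric]) auto

section \<open>The remainder after linearization and its L1 size\<close>

definition remainder :: "nat \<Rightarrow> 'm \<Rightarrow> real" where
  "remainder n \<omega> = Delta_n wp wq (\<lambda>i. Z i \<omega>) n - indep_dist wp wq mu - (\<Sum>i<n. infl (Z i \<omega>)) / n"

lemma Delta_n_measurable [measurable]: "(\<lambda>\<omega>. Delta_n wp wq (\<lambda>i. Z i \<omega>) n) \<in> borel_measurable M"
  unfolding Delta_n_def U1_def U2_def U3_def U4_def by measurable

lemma remainder_measurable [measurable]: "remainder n \<in> borel_measurable M"
  unfolding remainder_def by measurable

text \<open>The integrand in the error bound of \<open>indep_dist_linearization\<close>, taken at
  the empirical measure of the sample.\<close>

definition sq_dev :: "nat \<Rightarrow> 'm \<Rightarrow> 'a \<times> 'b \<Rightarrow> real" where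
  "sq_dev n \<omega> t = (cmod (cf (empirical (\<lambda>i. Z i \<omega>) n) t - cf mu t))\<^sup>2
          + (cmod (cf (empirical (\<lambda>i. fst (Z i \<omega>)) n) (fst t) - cf muX (fst t)))\<^sup>2
          + (cmod (cf (empirical (\<lambda>i. snd (Z i \<omega>)) n) (snd t) - cf muY (snd t)))\<^sup>2"

lemma sq_dev_nonneg: "0 \<le> sq_dev n \<omega> t"
  by (simp add: sq_dev_def)

lemma cf_empirical_diff_le:
  assumes "borel_prob P"
  shows "(cmod (cf (empirical z n) t - cf P t))\<^sup>2 \<le> 4"
proof -
  have "cmod (cf (empirical z n) t - cf P t) \<le> 2"
    using norm_triangle_ineq4[of "cf (empirical z n) t" "cf P t"]
      borel_prob.norm_cf_le[OF borel_prob_empirical, of z n t] borel_prob.norm_cf_le[OF assms, of t]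
    by simp
  from power_mono[OF this, of 2] show ?thesis by simp
qed

lemma sq_dev_le: "sq_dev n \<omega> t \<le> 12"
  using cf_empirical_diff_le[OF mu.borel_prob_axioms, of "\<lambda>i. Z i \<omega>" n t]
    cf_empirical_diff_le[OF muX.borel_prob_axioms, of "\<lambda>i. fst (Z i \<omega>)" n "fst t"]
    cf_empirical_diff_le[OF muY.borel_prob_axioms, of "\<lambda>i. snd (Z i \<omega>)" n "snd t"]
  unfolding sq_dev_def by linarith

lemma sq_dev_measurable:
  assumes "n > 0"
  shows "(\<lambda>p. sq_dev n (fst p) (snd p)) \<in> borel_measurable (M \<Otimes>\<^sub>M W)"
  unfolding sq_dev_def cf_empirical[OF assms] by measurable

text \<open>Fubini moves the expectation inside the \<open>W\<close>-integral. For fixed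
  \<open>t\<close> each of the three squared deviations has mean at most
  \<open>2 / n\<close>.\<close>

lemma expectation_sq_dev:
  assumes n: "n > 0"
  shows "M.expectation (\<lambda>\<omega>. \<integral>t. sq_dev n \<omega> t \<partial>W) \<le> 6 / n"
    and "integrable M (\<lambda>\<omega>. \<integral>t. sq_dev n \<omega> t \<partial>W)"
proof -
  interpret MW: pair_prob_space M W ..
  have int: "integrable (M \<Otimes>\<^sub>M W) (\<lambda>p. sq_dev n (fst p) (snd p))"
    by (rule MW.integrable_const_bound[of _ 12])
       (use sq_dev_measurable[OF n] sq_dev_le sq_dev_nonneg in auto)
  show "integrable M (\<lambda>\<omega>. \<integral>t. sq_dev n \<omega> t \<partial>W)"
    using MW.integrable_fst'[OF int] by simp
  have *: "M.expectation (\<lambda>\<omega>. \<integral>t. sq_dev n \<omega> t \<partial>W) = (\<integral>t. M.expectation (\<lambda>\<omega>. sq_dev n \<omega> t) \<partial>W)"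
    using MW.integral_fst'[OF int] MW.integral_snd[of "\<lambda>\<omega> t. sq_dev n \<omega> t"] int
    by (simp add: case_prod_unfold)
  have le: "M.expectation (\<lambda>\<omega>. sq_dev n \<omega> t) \<le> 6 / n" for t
  proof -
    have indX: "M.indep_vars (\<lambda>_. borel) (\<lambda>i \<omega>. fst (Z i \<omega>)) UNIV"
      and indY: "M.indep_vars (\<lambda>_. borel) (\<lambda>i \<omega>. snd (Z i \<omega>)) UNIV"
      by (rule M.indep_vars_compose2[OF indep_Z]; measurable)+
    have dX: "distr M borel (\<lambda>\<omega>. fst (Z i \<omega>)) = muX" and dY: "distr M borel (\<lambda>\<omega>. snd (Z i \<omega>)) = muY" for i
      unfolding muX_def muY_def by (intro distr_compose_Z; measurable)+
    \<comment> \<open>Stated for a general value space to serve the pair and both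
      coordinates.\<close>
    have int: "integrable M (\<lambda>\<omega>. (cmod (cf (empirical (\<lambda>i. V i \<omega>) n) s - cf P s))\<^sup>2)"
      if "borel_prob P" and [measurable]: "\<And>i. V i \<in> borel_measurable M"
      for P :: "'c::euclidean_space measure" and V s
    proof (rule M.integrable_const_bound[of _ 4])
      show "AE \<omega> in M. norm ((cmod (cf (empirical (\<lambda>i. V i \<omega>) n) s - cf P s))\<^sup>2) \<le> 4"
        using cf_empirical_diff_le[OF that(1)] by simp
      show "(\<lambda>\<omega>. (cmod (cf (empirical (\<lambda>i. V i \<omega>) n) s - cf P s))\<^sup>2) \<in> borel_measurable M"
        unfolding cf_empirical[OF n] by measurable
    qed
    have "M.expectation (\<lambda>\<omega>. sq_dev n \<omega> t) \<le> 2 / n + 2 / n + 2 / n"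
      unfolding sq_dev_def
      using M.mean_square_deviation_cis_le[OF indep_Z distr_Z n, of t]
        M.mean_square_deviation_cis_le[OF indX dX n, of "fst t"]
        M.mean_square_deviation_cis_le[OF indY dY n, of "snd t"]
      by (simp add: int mu.borel_prob_axioms muX.borel_prob_axioms muY.borel_prob_axioms)
    then show ?thesis by simp
  qed
  have "integrable W (\<lambda>t. M.expectation (\<lambda>\<omega>. sq_dev n \<omega> t))"
    using MW.integrable_snd[of "\<lambda>\<omega> t. sq_dev n \<omega> t"] int by (simp add: case_prod_unfold)
  then have "(\<integral>t. M.expectation (\<lambda>\<omega>. sq_dev n \<omega> t) \<partial>W) \<le> (\<integral>t. 6 / n \<partial>W)"
    using le by (intro integral_mono) auto
  then show "M.expectation (\<lambda>\<omega>. \<integral>t. sq_dev n \<omega> t \<partial>W) \<le> 6 / n"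
    unfolding * using W.prob_space by simp
qed

text \<open>The first summand is the price of passing from U- to V-statistics, the second the
  linearization error at the empirical measure.\<close>

lemma abs_remainder_le:
  assumes n: "n \<ge> 3"
  shows "\<bar>remainder n \<omega>\<bar> \<le> 18 / n + 5 * (\<integral>t. sq_dev n \<omega> t \<partial>W)"
proof -
  let ?N = "empirical (\<lambda>i. Z i \<omega>) n"
  have n0: "n > 0" using n by simp
  have "(\<integral>z. infl z \<partial>?N) = (\<Sum>i<n. infl (Z i \<omega>)) / n"
    by (subst integral_empirical) (use n0 in \<open>auto simp: field_simps\<close>)
  then show ?thesis
    using indep_dist_linearization[OF borel_prob_empirical, of "\<lambda>i. Z i \<omega>" n]
      Delta_n_empirical[OF n, of "\<lambda>i. Z i \<omega>"]
    unfolding remainder_def sq_dev_def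
      distr_empirical[OF measurable_fst_borel] distr_empirical[OF measurable_snd_borel]
    by linarith
qed

lemma expectation_remainder:
  assumes n: "n \<ge> 3"
  shows "integrable M (remainder n)" and "M.expectation (\<lambda>\<omega>. \<bar>remainder n \<omega>\<bar>) \<le> 48 / n"
proof -
  have n0: "n > 0" using n by simp
  note sq = expectation_sq_dev[OF n0]
  have int: "integrable M (\<lambda>\<omega>. 18 / n + 5 * (\<integral>t. sq_dev n \<omega> t \<partial>W))"
    using sq(2) by simp
  show rem: "integrable M (remainder n)"
    by (rule Bochner_Integration.integrable_bound[OF int])
       (use order.trans[OF abs_remainder_le[OF n] abs_ge_self] in auto)
  have "M.expectation (\<lambda>\<omega>. \<bar>remainder n \<omega>\<bar>) \<le> M.expectation (\<lambda>\<omega>. 18 / n + 5 * (\<integral>t. sq_dev n \<omega> t \<partial>W))"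
    by (rule integral_mono) (use rem int abs_remainder_le[OF n] in auto)
  also have "\<dots> = 18 / n + 5 * M.expectation (\<lambda>\<omega>. \<integral>t. sq_dev n \<omega> t \<partial>W)"
    using sq(2) by (simp add: M.prob_space)
  \<comment> \<open>48 = 18 + 5 * 6.\<close>
  also have "\<dots> \<le> 48 / n"
    using sq(1) by simp
  finally show "M.expectation (\<lambda>\<omega>. \<bar>remainder n \<omega>\<bar>) \<le> 48 / n" .
qed

lemma sqrt_expectation_remainder:
  assumes n: "n \<ge> 3"
  shows "M.expectation (\<lambda>\<omega>. \<bar>sqrt n * remainder n \<omega>\<bar>) \<le> 48 / sqrt n"
proof -
  have "M.expectation (\<lambda>\<omega>. \<bar>sqrt n * remainder n \<omega>\<bar>) = sqrt n * M.expectation (\<lambda>\<omega>. \<bar>remainder n \<omega>\<bar>)"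
    by (simp add: abs_mult)
  also have "\<dots> \<le> sqrt n * (48 / n)"
    by (intro mult_left_mono expectation_remainder n) auto
  also have "\<dots> = 48 / sqrt n"
    using n by (simp add: field_simps flip: power2_eq_square)
  finally show ?thesis .
qed

lemma bound_tendsto_0: "(\<lambda>n. 48 / sqrt (real n)) \<longlonglongrightarrow> 0"
  by (intro tendsto_divide_0[OF tendsto_const] filterlim_at_top_imp_at_infinity
      filterlim_compose[OF sqrt_at_top filterlim_real_sequentially])

section \<open>Central limit theorem for the linear part\<close>

lemma expectation_infl: "M.expectation (\<lambda>\<omega>. infl (Z i \<omega>)) = 0"
  "M.expectation (\<lambda>\<omega>. (infl (Z i \<omega>))\<^sup>2) = sigma2 wp wq mu"
  using expectation_compose_Z[of infl i] expectation_compose_Z[of "\<lambda>z. (infl z)\<^sup>2" i]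
  by (simp_all add: integral_infl_mu sigma2_eq)

lemma integrable_infl_sq: "integrable M (\<lambda>\<omega>. (infl (Z i \<omega>))\<^sup>2)"
proof (rule M.integrable_const_bound[of _ "24\<^sup>2"])
  have "(infl z)\<^sup>2 \<le> 24\<^sup>2" for z
    using power_mono[OF abs_infl_le[of z], of 2] by simp
  then show "AE \<omega> in M. norm ((infl (Z i \<omega>))\<^sup>2) \<le> 24\<^sup>2" by simp
qed measurable

lemma sigma2_nonneg: "0 \<le> sigma2 wp wq mu"
  by (simp add: sigma2_eq)

text \<open>With variance 0 the terms \<open>infl (Z i)\<close> vanish almost surely and the limit
  is a point mass. With positive variance the central limit theorem for the standardized sum
  applies.\<close>

lemma char_linear_part:
  "(\<lambda>n. char (distr M borel (\<lambda>\<omega>. sqrt n * ((\<Sum>i<n. infl (Z i \<omega>)) / n))) t)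
     \<longlonglongrightarrow> char (normal_law (sigma2 wp wq mu)) t"
proof (cases "sigma2 wp wq mu = 0")
  case True
  have "AE \<omega> in M. infl (Z i \<omega>) = 0" for i
    using integral_nonneg_eq_0_iff_AE[OF integrable_infl_sq[of i]] expectation_infl(2)[of i] True by simp
  then have AE: "AE \<omega> in M. \<forall>i. infl (Z i \<omega>) = 0"
    by (simp add: AE_all_countable)
  have "char (distr M borel (\<lambda>\<omega>. sqrt n * ((\<Sum>i<n. infl (Z i \<omega>)) / n))) t = 1" for n :: nat
  proof -
    have "char (distr M borel (\<lambda>\<omega>. sqrt n * ((\<Sum>i<n. infl (Z i \<omega>)) / n))) t
        = (CLINT \<omega>|M. iexp (t * (sqrt n * ((\<Sum>i<n. infl (Z i \<omega>)) / n))))"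
      by (rule M.char_distr) measurable
    also have "\<dots> = (CLINT \<omega>|M. 1)"
      by (rule integral_cong_AE) (use AE in \<open>auto elim!: eventually_mono\<close>)
    finally show ?thesis by (simp add: M.prob_space)
  qed
  then show ?thesis
    using char_normal_law[OF sigma2_nonneg, of t] True by simp
next
  case False
  define \<sigma> where "\<sigma> = sqrt (sigma2 wp wq mu)"
  have \<sigma>: "\<sigma> > 0" "\<sigma>\<^sup>2 = sigma2 wp wq mu"
    using False sigma2_nonneg by (auto simp: \<sigma>_def)
  have ind: "M.indep_vars (\<lambda>i. borel) (\<lambda>i \<omega>. infl (Z i \<omega>)) UNIV"
    by (rule M.indep_vars_compose2[OF indep_Z]) measurable
  have dist: "distr M borel (\<lambda>\<omega>. infl (Z i \<omega>)) = distr mu borel infl" for i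
    by (rule distr_compose_Z) measurable
  have clt: "weak_conv_m (\<lambda>n. distr M borel (\<lambda>\<omega>. (\<Sum>i<n. infl (Z i \<omega>)) / sqrt (n * \<sigma>\<^sup>2))) std_normal_distribution"
    by (rule M.central_limit_theorem_zero_mean[OF ind expectation_infl(1) \<sigma>(1) integrable_infl_sq _ dist])
       (simp add: expectation_infl \<sigma>(2))
  \<comment> \<open>Evaluating at \<open>\<sigma> * t\<close> undoes the standardization by
    \<open>\<sigma>\<close>.\<close>
  have "(\<lambda>n. char (distr M borel (\<lambda>\<omega>. (\<Sum>i<n. infl (Z i \<omega>)) / sqrt (n * \<sigma>\<^sup>2))) (\<sigma> * t))
      \<longlonglongrightarrow> char std_normal_distribution (\<sigma> * t)"
    by (rule levy_continuity1[OF _ _ clt]) (auto intro: real_dist_normal_dist)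
  also have "char std_normal_distribution (\<sigma> * t) = char (normal_law (sigma2 wp wq mu)) t"
    unfolding char_normal_law[OF sigma2_nonneg] char_std_normal_distribution
    by (simp add: power_mult_distrib \<sigma>(2))
  also have "(\<lambda>n. char (distr M borel (\<lambda>\<omega>. (\<Sum>i<n. infl (Z i \<omega>)) / sqrt (n * \<sigma>\<^sup>2))) (\<sigma> * t))
      = (\<lambda>n. char (distr M borel (\<lambda>\<omega>. sqrt n * ((\<Sum>i<n. infl (Z i \<omega>)) / n))) t)"
  proof
    fix n :: nat
    have scale: "\<sigma> * t * (x / sqrt (n * \<sigma>\<^sup>2)) = t * (sqrt n * (x / n))" for x
    \<comment> \<open>For \<open>n = 0\<close> both sides are 0, as division by 0 yields 0.\<close>
    proof (cases "n = 0")
      case False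
      then have "sqrt n * sqrt n = n" "sqrt n > 0" by auto
      then show ?thesis
        using \<sigma>(1) False by (simp add: real_sqrt_mult divide_simps)
    qed simp
    show "char (distr M borel (\<lambda>\<omega>. (\<Sum>i<n. infl (Z i \<omega>)) / sqrt (n * \<sigma>\<^sup>2))) (\<sigma> * t)
        = char (distr M borel (\<lambda>\<omega>. sqrt n * ((\<Sum>i<n. infl (Z i \<omega>)) / n))) t"
      by (subst (1 2) M.char_distr; (simp only: scale | measurable))
  qed
  finally show ?thesis .
qed

section \<open>The two limit statements\<close>

lemma weak_conv_Delta_n:
  "weak_conv_m
     (\<lambda>n. distr M borel (\<lambda>\<omega>. sqrt (real n) * (Delta_n wp wq (\<lambda>i. Z i \<omega>) n - indep_dist wp wq mu)))
     (normal_law (sigma2 wp wq mu))"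
proof -
  let ?Y = "\<lambda>n \<omega>. sqrt (real n) * ((\<Sum>i<n. infl (Z i \<omega>)) / n)"
  have diff: "sqrt (real n) * (Delta_n wp wq (\<lambda>i. Z i \<omega>) n - indep_dist wp wq mu) - ?Y n \<omega>
      = sqrt n * remainder n \<omega>" for n \<omega>
    by (simp add: remainder_def algebra_simps)
  show ?thesis
  proof (rule M.weak_conv_L1_perturbation[where Y = ?Y])
    show "(\<lambda>\<omega>. sqrt n * (Delta_n wp wq (\<lambda>i. Z i \<omega>) n - indep_dist wp wq mu)) \<in> borel_measurable M"
      "?Y n \<in> borel_measurable M" for n
      by measurable
    show "\<forall>\<^sub>F n in sequentially. integrable M
        (\<lambda>\<omega>. sqrt (real n) * (Delta_n wp wq (\<lambda>i. Z i \<omega>) n - indep_dist wp wq mu) - ?Y n \<omega>)"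
      unfolding diff using eventually_ge_at_top[of 3]
      by eventually_elim (simp add: expectation_remainder)
    show "(\<lambda>n. M.expectation
        (\<lambda>\<omega>. \<bar>sqrt (real n) * (Delta_n wp wq (\<lambda>i. Z i \<omega>) n - indep_dist wp wq mu) - ?Y n \<omega>\<bar>)) \<longlonglongrightarrow> 0"
      unfolding diff
      by (rule tendsto_sandwich[OF _ _ tendsto_const bound_tendsto_0])
         (auto intro!: eventually_sequentiallyI[of 3] sqrt_expectation_remainder)
    show "real_distribution (normal_law (sigma2 wp wq mu))"
      by (rule real_distribution_normal_law[OF sigma2_nonneg])
    show "(\<lambda>n. char (distr M borel (?Y n)) t) \<longlonglongrightarrow> char (normal_law (sigma2 wp wq mu)) t" for t
      by (rule char_linear_part)
  qed
qed

text \<open>With \<open>infl\<close> identically zero, \<open>Delta_n\<close> is the remainder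
  alone, and Markov's inequality turns its L1 bound into a bound on the probability.\<close>

lemma Delta_n_tendsto_in_prob:
  assumes 0: "indep_dist wp wq mu = 0" and e: "e > 0"
  shows "(\<lambda>n. measure M {\<omega> \<in> space M. \<bar>sqrt (real n) * Delta_n wp wq (\<lambda>i. Z i \<omega>) n\<bar> > e}) \<longlonglongrightarrow> 0"
proof -
  have eq: "Delta_n wp wq (\<lambda>i. Z i \<omega>) n = remainder n \<omega>" for n \<omega>
    by (simp add: remainder_def 0 infl_eq_0)
  have bound: "M.prob {\<omega> \<in> space M. \<bar>sqrt n * remainder n \<omega>\<bar> > e} \<le> 48 / sqrt n / e" if n: "n \<ge> 3" for n
  proof -
    \<comment> \<open>Markov's inequality is stated for the weak inequality, so the event is
      enlarged first.\<close>
    have "M.prob {\<omega> \<in> space M. \<bar>sqrt n * remainder n \<omega>\<bar> > e}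
        \<le> M.prob {\<omega> \<in> space M. \<bar>sqrt n * remainder n \<omega>\<bar> \<ge> e}"
      by (rule M.finite_measure_mono) auto
    also have "\<dots> \<le> M.expectation (\<lambda>\<omega>. \<bar>sqrt n * remainder n \<omega>\<bar>) / e"
      by (rule integral_Markov_inequality_measure[where A = "space M"])
         (use e expectation_remainder[OF n] in auto)
    also have "\<dots> \<le> 48 / sqrt n / e"
      using e sqrt_expectation_remainder[OF n] by (intro divide_right_mono) auto
    finally show ?thesis .
  qed
  have lim: "(\<lambda>n. 48 / sqrt (real n) / e) \<longlonglongrightarrow> 0"
    using tendsto_divide[OF bound_tendsto_0 tendsto_const[of e]] e by simp
  show ?thesis
    unfolding eq
    by (rule tendsto_sandwich[OF _ _ tendsto_const lim])
       (use bound in \<open>auto intro!: eventually_sequentiallyI[of 3] simp del: divide_divide_eq_left\<close>)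
qed

end

theorem theorem1:
  fixes M :: "'m measure"
    and Z :: "nat \<Rightarrow> 'm \<Rightarrow> ('a::euclidean_space \<times> 'b::euclidean_space)"
    and mu :: "('a \<times> 'b) measure"
    and wp :: "'a \<Rightarrow> real" and wq :: "'b \<Rightarrow> real"
  assumes "prob_space M"
    and "\<And>i. Z i \<in> borel_measurable M"
    and "prob_space.indep_vars M (\<lambda>_. borel) Z UNIV"
    and "\<And>i. distr M borel (Z i) = mu"
    and "weightA wp" and "weightA wq"
  shows "(indep_dist wp wq mu > 0 \<longrightarrow>
           weak_conv_m
             (\<lambda>n. distr M borel (\<lambda>\<omega>. sqrt (real n) *
                     (Delta_n wp wq (\<lambda>i. Z i \<omega>) n - indep_dist wp wq mu)))
             (normal_law (sigma2 wp wq mu)))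
       \<and> (indep_dist wp wq mu = 0 \<longrightarrow>
           (\<forall>e>0. (\<lambda>n. measure M {\<omega> \<in> space M.
                     \<bar>sqrt (real n) * Delta_n wp wq (\<lambda>i. Z i \<omega>) n\<bar> > e}) \<longlonglongrightarrow> 0))"
proof -
  interpret M: prob_space M by fact
  interpret mu: borel_prob mu
    unfolding assms(4)[of 0, symmetric] by (rule borel_prob_distr) (use assms in auto)
  interpret indep_sample wp wq mu M Z
    by unfold_locales (use assms in auto)
  show ?thesis
    by (intro conjI impI allI weak_conv_Delta_n Delta_n_tendsto_in_prob)
qed

end
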